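(* Consider a one-sided truncated exponential family with natural parameter $\theta$, truncation parameter $\gamma$ and expectation parameter $\eta$. Fix $\eta_0\in H'$ and consider the submodel $\mathcal M_{e,\eta_0}=\{p(x;\eta_0,\gamma):\gamma\in I'_{\eta_0}\}$. Then there exist a unique probability matching prior $\pi_{PM}^{\gamma}$ and a unique moment matching prior $\pi_{MM}^{\gamma}$ for $\gamma$ on $\mathcal M_{e,\eta_0}$ (up to proportionality), and they satisfy $$\pi_{PM}^{\gamma}(\gamma)\propto V^{(1/2,0)}(\eta_0,\gamma)=\det g_\theta(\eta_0,\gamma)\,\sqrt{g_{\gamma\gamma}(\eta_0,\gamma)},$$ $$\pi_{MM}^{\gamma}(\gamma)\propto V^{(0,1/2)}(\eta_0,\gamma)=\sqrt{\det g_\theta(\eta_0,\gamma)}\;g_{\gamma\gamma}(\eta_0,\gamma).$$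
   Context: One-sided truncated exponential family (oTEF): $\Theta\subset\mathbb R^d$ is open, $I=(I_1,I_2)$ is an open interval with $-\infty\le I_1<I_2\le\infty$, and $\{P_{\theta,\gamma}:\theta\in\Theta,\gamma\in I\}$ are probability distributions with Lebesgue densities $p(x;\theta,\gamma)=q(x;\theta)e^{-\psi(\theta,\gamma)}\mathbf 1_{[\gamma,I_2)}(x)$, $x\in I$, where $q(x;\theta)=\exp\{\sum_{i=1}^d\theta^iF_i(x)+M(x)\}$, $M\in C(I)$, $F_i\in C^\infty(I)$. The family is identifiable in the sense that $P_{\theta_1,\gamma}=P_{\theta_2,\gamma}$ implies $\theta_1=\theta_2$, and $p(x;\theta,\gamma)$ is infinitely differentiable in $\theta$ and $\gamma$ for $x\in(\gamma,I_2)$. Notation: $\partial_i=\partial/\partial\theta^i$, $\partial_\gamma=\partial/\partial\gamma$ (in the coordinates $(\theta,\gamma)$); $g_{ij}=-E[\partial_i\partial_j\log p(X;\theta,\gamma)]=\partial_i\partial_j\psi$, $g_\theta=(g_{ij})_{1\le i,j\le d}$, $(g^{ij})=g_\theta^{-1}$, $g_{\gamma\gamma}=(\partial_\gamma\psi)^2$, $A^{(1,1)}_i=E[\partial_i\partial_\gamma\log p(X;\theta,\gamma)]=-\partial_i\partial_\gamma\psi$. The extended volume element is $V^{(\rho,\tau)}=(\det g_\theta)^{\rho+1/2}(g_{\gamma\gamma})^{\tau+1/2}$ for $\rho,\tau\in\mathbb R$, with $g_\theta$ and $g_{\gamma\gamma}$ the components of the metric in the coordinates $(\theta,\gamma)$.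 Expectation parameters: $\eta=\eta(\theta,\gamma)=(\partial_1\psi,\dots,\partial_d\psi)$, so $\eta_i=E[F_i(X)]$. The family is reparametrized by $(\theta,\gamma)\mapsto(\eta,\gamma')=(\eta(\theta,\gamma),\gamma)$, with parameter space $H=\{(\eta(\theta,\gamma),\gamma):\theta\in\Theta,\gamma\in I\}$. Put $H'=\{\eta(\theta,\gamma):\theta\in\Theta,\gamma\in I\}$ and $I'_{\eta_0}=\{\gamma:(\eta_0,\gamma)\in H\}$. Writing $f(\eta_0,\gamma)$, or $p(x;\eta_0,\gamma)$, means the value of the function (density) at the point of the family whose coordinates are $(\eta_0,\gamma)$. In the $(\eta,\gamma')$ coordinates, $\partial/\partial\gamma'$ is the vector field $\chi=\partial_\gamma+\sum_{i,j}A^{(1,1)}_ig^{ij}\partial_j$. Matching priors on the submodel: on the oTEF the condition for a prior $\pi$ to be a probability matching prior for $\gamma$ is $\chi\{\log\pi-\log(\det g_\theta)-\frac12\log g_{\gamma\gamma}\}=0$, and the condition for it to be a moment matching prior for $\gamma$ is $\chi\{\log\pi-\frac12\log(\det g_\theta)-\log g_{\gamma\gamma}\}=0$. A probability (respectively moment) matching prior for $\gamma$ on $\mathcal M_{e,\eta_0}$ is a positive differentiable function $\pi(\gamma)$ on $I'_{\eta_0}$ satisfying the corresponding condition restricted to $\mathcal M_{e,\eta_0}$, i.e. $\frac{d}{d\gamma}\{\log\pi(\gamma)-\log V^{(1/2,0)}(\eta_0,\gamma)\}=0$ (respectively $\frac{d}{d\gamma}\{\log\pi(\gamma)-\log V^{(0,1/2)}(\eta_0,\gamma)\}=0$),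 the derivative being taken at fixed $\eta_0$.
   Formalization: Uniqueness up to proportionality is proved on each connected subset of I'_{η0}, hence on all of I'_{η0} when it is connected; for disconnected I'_{η0} (possible for open Θ) a single global constant fails. Existence of priors proportional to V on all of I'_{η0} is unconditional. *)

theory Defs
  imports "HOL-Probability.Probability"
begin

text \<open>
  Used on open sets \<open>S\<close> only.  At order \<open>n\<close> all iterated directional derivatives up to order \<open>n\<close>
  exist (as values of Frechet derivatives) and are continuous.
\<close>

fun higher_differentiable_on ::
    "'a::real_normed_vector set \<Rightarrow> ('a \<Rightarrow> 'b::real_normed_vector) \<Rightarrow> nat \<Rightarrow> bool" where
  "higher_differentiable_on S f 0 \<longleftrightarrow> continuous_on S f"
| "higher_differentiable_on S f (Suc n) \<longleftrightarrow>
     (\<forall>x\<in>S. f differentiable (at x)) \<and>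
     (\<forall>v. higher_differentiable_on S (\<lambda>x. frechet_derivative f (at x) v) n)"

definition smooth_on ::
    "'a::real_normed_vector set \<Rightarrow> ('a \<Rightarrow> 'b::real_normed_vector) \<Rightarrow> bool" where
  "smooth_on S f \<longleftrightarrow> (\<forall>n. higher_differentiable_on S f n)"

definition partial :: "'d::finite \<Rightarrow> (real ^ 'd \<Rightarrow> real) \<Rightarrow> real ^ 'd \<Rightarrow> real" where
  "partial i f \<theta> = deriv (\<lambda>t. f (\<theta> + t *\<^sub>R axis i 1)) 0"

text \<open>
  The set matters: if the parameter set of a submodel is disconnected, as it is for
  \<open>p x \<theta> \<gamma> = \<theta> * exp (- \<theta> * (x - \<gamma>))\<close> with \<open>\<theta>\<close> in \<open>{1<..<2} \<union> {5<..<6}\<close> and fixed mean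
  \<open>\<gamma> + 1 / \<theta> = 0\<close>, then a condition on derivatives determines a prior only up to one factor on
  each connected subset.
\<close>

definition proportional_on :: "'a set \<Rightarrow> ('a \<Rightarrow> real) \<Rightarrow> ('a \<Rightarrow> real) \<Rightarrow> bool" where
  "proportional_on S f g \<longleftrightarrow> (\<exists>c>0. \<forall>x\<in>S. f x = c * g x)"

text \<open>
  The normalizer \<open>\<psi>\<close> is a parameter; the assumption that every \<open>P \<theta> \<gamma>\<close> is a probability
  measure (see the locale \<open>oTEF\<close> below) determines it on \<open>\<Theta> \<times> I\<close>.  Values of \<open>F\<close> and \<open>M\<close>
  outside \<open>I\<close>, and of \<open>\<psi>\<close> outside \<open>\<Theta> \<times> I\<close>, are irrelevant: the parameter sets are open.
\<close>

locale oTEF_data =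
  fixes \<Theta> :: "(real ^ 'd::finite) set"
    and I1 I2 :: ereal
    and F :: "'d \<Rightarrow> real \<Rightarrow> real"
    and M :: "real \<Rightarrow> real"
    and \<psi> :: "real ^ 'd \<Rightarrow> real \<Rightarrow> real"
begin

definition I :: "real set" where
  "I = einterval I1 I2"

definition q :: "real \<Rightarrow> real ^ 'd \<Rightarrow> real" where
  "q x \<theta> = exp ((\<Sum>i\<in>UNIV. \<theta> $ i * F i x) + M x)"

definition p :: "real \<Rightarrow> real ^ 'd \<Rightarrow> real \<Rightarrow> real" where
  "p x \<theta> \<gamma> = q x \<theta> * exp (- \<psi> \<theta> \<gamma>) * indicator {y. \<gamma> \<le> y \<and> ereal y < I2} x"

definition P :: "real ^ 'd \<Rightarrow> real \<Rightarrow> real measure" where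
  "P \<theta> \<gamma> = density lborel (\<lambda>x. ennreal (p x \<theta> \<gamma>))"

text \<open>
  The integrand below vanishes for \<open>x < \<gamma>\<close>, where \<open>p\<close> is constantly 0 in \<open>\<theta>\<close>; this is a
  \<open>P \<theta> \<gamma>\<close>-null set.
\<close>

definition g_theta :: "real ^ 'd \<Rightarrow> real \<Rightarrow> real ^ 'd ^ 'd" where
  "g_theta \<theta> \<gamma> = (\<chi> i j. - (\<integral>x. partial i (partial j (\<lambda>\<theta>'. ln (p x \<theta>' \<gamma>))) \<theta> \<partial>P \<theta> \<gamma>))"

definition g_gamma :: "real ^ 'd \<Rightarrow> real \<Rightarrow> real" where
  "g_gamma \<theta> \<gamma> = (deriv (\<psi> \<theta>) \<gamma>)\<^sup>2"

definition V :: "real \<Rightarrow> real \<Rightarrow> real ^ 'd \<Rightarrow> real \<Rightarrow> real" where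
  "V \<rho> \<tau> \<theta> \<gamma> = det (g_theta \<theta> \<gamma>) powr (\<rho> + 1/2) * g_gamma \<theta> \<gamma> powr (\<tau> + 1/2)"

definition eta :: "real ^ 'd \<Rightarrow> real \<Rightarrow> real ^ 'd" where
  "eta \<theta> \<gamma> = (\<chi> i. partial i (\<lambda>\<theta>'. \<psi> \<theta>' \<gamma>) \<theta>)"

definition H :: "((real ^ 'd) \<times> real) set" where
  "H = {(eta \<theta> \<gamma>, \<gamma>) |\<theta> \<gamma>. \<theta> \<in> \<Theta> \<and> \<gamma> \<in> I}"

definition H' :: "(real ^ 'd) set" where
  "H' = {eta \<theta> \<gamma> |\<theta> \<gamma>. \<theta> \<in> \<Theta> \<and> \<gamma> \<in> I}"

definition I' :: "real ^ 'd \<Rightarrow> real set" where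
  "I' \<eta>0 = {\<gamma>. (\<eta>0, \<gamma>) \<in> H}"

text \<open>
  The value of a function \<open>f\<close> of \<open>(\<theta>, \<gamma>)\<close> at the point whose mixed coordinates are \<open>(\<eta>0, \<gamma>)\<close>;
  \<open>\<theta> \<mapsto> eta \<theta> \<gamma>\<close> is injective on \<open>\<Theta>\<close> because \<open>\<psi>\<close> is strictly convex in \<open>\<theta>\<close> for an
  identifiable family.
\<close>

definition at_eta :: "(real ^ 'd \<Rightarrow> real \<Rightarrow> 'b) \<Rightarrow> real ^ 'd \<Rightarrow> real \<Rightarrow> 'b" where
  "at_eta f \<eta>0 \<gamma> = f (THE \<theta>. \<theta> \<in> \<Theta> \<and> eta \<theta> \<gamma> = \<eta>0) \<gamma>"

text \<open>
  Priors on the submodel with \<open>\<eta> = \<eta>0\<close> are functions on \<open>I' \<eta>0\<close>.  The set \<open>I' \<eta>0\<close> is open, so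
  that derivatives within it are ordinary derivatives not depending on values outside.
\<close>

definition prob_matching_prior :: "real ^ 'd \<Rightarrow> (real \<Rightarrow> real) \<Rightarrow> bool" where
  "prob_matching_prior \<eta>0 \<pi> \<longleftrightarrow>
     (\<forall>\<gamma>\<in>I' \<eta>0. \<pi> \<gamma> > 0) \<and> \<pi> differentiable_on I' \<eta>0 \<and>
     (\<forall>\<gamma>\<in>I' \<eta>0. ((\<lambda>\<gamma>'. ln (\<pi> \<gamma>') - ln (at_eta (V (1/2) 0) \<eta>0 \<gamma>'))
        has_real_derivative 0) (at \<gamma> within I' \<eta>0))"

definition moment_matching_prior :: "real ^ 'd \<Rightarrow> (real \<Rightarrow> real) \<Rightarrow> bool" where
  "moment_matching_prior \<eta>0 \<pi> \<longleftrightarrow>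
     (\<forall>\<gamma>\<in>I' \<eta>0. \<pi> \<gamma> > 0) \<and> \<pi> differentiable_on I' \<eta>0 \<and>
     (\<forall>\<gamma>\<in>I' \<eta>0. ((\<lambda>\<gamma>'. ln (\<pi> \<gamma>') - ln (at_eta (V 0 (1/2)) \<eta>0 \<gamma>'))
        has_real_derivative 0) (at \<gamma> within I' \<eta>0))"

end

locale oTEF = oTEF_data \<Theta> I1 I2 F M \<psi>
  for \<Theta> :: "(real ^ 'd::finite) set" and I1 I2 F M \<psi> +
  assumes open_Theta: "open \<Theta>"
    and I1_less_I2: "I1 < I2"
    and cont_M: "continuous_on I M"
    and smooth_F: "smooth_on I (F i)"
    and prob: "\<lbrakk>\<theta> \<in> \<Theta>; \<gamma> \<in> I\<rbrakk> \<Longrightarrow> prob_space (P \<theta> \<gamma>)"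
    and identifiable:
      "\<lbrakk>\<theta>1 \<in> \<Theta>; \<theta>2 \<in> \<Theta>; \<gamma> \<in> I; P \<theta>1 \<gamma> = P \<theta>2 \<gamma>\<rbrakk> \<Longrightarrow> \<theta>1 = \<theta>2"
    and smooth_p: "x \<in> I \<Longrightarrow> smooth_on (\<Theta> \<times> {\<gamma>\<in>I. \<gamma> < x}) (\<lambda>(\<theta>, \<gamma>). p x \<theta> \<gamma>)"

end

theory Submission
  imports Defs
begin

text \<open>
  A matching prior satisfies a differential equation on the submodel of fixed \<open>\<eta>0\<close>: the logarithm of
  its quotient by the extended volume element \<open>V\<close>, written as a function of \<open>\<gamma>\<close>, has derivative
  \<open>0\<close>.  Hence \<open>V\<close> itself is a matching prior as soon as it is positive and differentiable along the
  submodel, and every other one is a constant multiple of it on each connected set of parameters.  The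
  work is in the positivity and the differentiability of \<open>V\<close>, which is built from \<open>det g_theta\<close>
  and from \<open>g_gamma\<close>.

  Differentiability.  For a sample point \<open>x > \<gamma>\<close> the log-normalizer is an affine function of
  \<open>\<theta>\<close> minus \<open>ln (p x \<theta> \<gamma>)\<close>, so the smoothness of the density makes \<open>\<psi>\<close> jointly
  smooth (\<open>smooth_psi\<close>), and \<open>g_theta\<close> is its Hessian in \<open>\<theta>\<close> (\<open>g_theta_eq\<close>).  The
  submodel is reached by inverting \<open>(\<theta>, \<gamma>) \<mapsto> (eta \<theta> \<gamma>, \<gamma>)\<close>.  This map is injective
  (\<open>eta_inj\<close>) with injective derivative, so its inverse is differentiable
  (\<open>mixed_inv_differentiable\<close>).

  Positivity.  In a direction \<open>v\<close> the moment generating function of \<open>v \<bullet> F\<close> under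
  \<open>P \<theta> \<gamma>\<close> is \<open>exp (\<psi> (\<theta> + t v) \<gamma> - \<psi> \<theta> \<gamma>)\<close>.  Its first derivative gives the mean
  \<open>v \<bullet> eta \<theta> \<gamma>\<close>; a second difference bounds the second derivative of \<open>\<psi>\<close> from below by the
  variance.  In place of differentiation under the integral sign, both facts use the inequalities
  \<open>1 + y \<le> exp y\<close> and \<open>2 + y\<^sup>2 \<le> exp y + exp (- y)\<close> together with the conditions
  for a minimum at \<open>t = 0\<close>.  A vanishing variance would make \<open>v \<bullet> F\<close> almost surely constant, which
  identifiability excludes (\<open>eq_if_stat_AE_const\<close>); so the Hessian is positive definite
  (\<open>hessian_pos\<close>) and its determinant is positive.  The same rigidity, applied to the relative entropy
  of two members with the same \<open>\<gamma>\<close>, gives the injectivity of \<open>eta\<close>.  Finally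
  \<open>exp (\<psi> \<theta> \<gamma>)\<close> is the integral of the positive function \<open>q\<close> over \<open>[\<gamma>, I2)\<close>, so
  \<open>\<psi>\<close> has negative derivative in \<open>\<gamma>\<close> and \<open>g_gamma > 0\<close>.
\<close>

section \<open>Iterated differentiability\<close>

text \<open>
  The open set matters: the iterated derivatives at a point see the values on a neighbourhood.
\<close>
lemma higher_differentiable_on_cong:
  fixes f g :: "'a::real_normed_vector \<Rightarrow> 'b::real_normed_vector"
  assumes "open S" and "\<And>x. x \<in> S \<Longrightarrow> f x = g x" and "higher_differentiable_on S f n"
  shows "higher_differentiable_on S g n"
  using assms(2,3)
proof (induction n arbitrary: f g)
  case 0
  then show ?case using continuous_on_cong by fastforce
next
  case (Suc n)
  have der: "(g has_derivative frechet_derivative f (at x)) (at x)" if "x \<in> S" for x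
    using Suc.prems that \<open>open S\<close>
    by (auto intro: has_derivative_transform_within_open simp: frechet_derivative_works)
  then have "frechet_derivative f (at x) v = frechet_derivative g (at x) v" if "x \<in> S" for x v
    using that frechet_derivative_at by metis
  then have "higher_differentiable_on S (\<lambda>x. frechet_derivative g (at x) v) n" for v
    using Suc.IH Suc.prems(2) by (metis (no_types, lifting) higher_differentiable_on.simps(2))
  then show ?case using der by (auto simp: differentiable_def)
qed

text \<open>
  Introduces one more order from any explicitly known derivative, so that the closure properties below
  can be proved by induction with the usual product and chain rules.
\<close>
lemma higher_differentiable_on_SucI:
  assumes "open S" and der: "\<And>x. x \<in> S \<Longrightarrow> (f has_derivative f' x) (at x)"
    and diff: "\<And>v. higher_differentiable_on S (\<lambda>x. f' x v) n"
  shows "higher_differentiable_on S f (Suc n)"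
proof -
  have "f' x v = frechet_derivative f (at x) v" if "x \<in> S" for x v
    using frechet_derivative_at[OF der[OF that]] by simp
  then have "higher_differentiable_on S (\<lambda>x. frechet_derivative f (at x) v) n" for v
    by (rule higher_differentiable_on_cong[OF \<open>open S\<close> _ diff])
  then show ?thesis using der by (auto simp: differentiable_def)
qed

lemma higher_differentiable_on_SucD:
  assumes "higher_differentiable_on S f (Suc n)"
  shows "higher_differentiable_on S f n"
  using assms
proof (induction n arbitrary: f)
  case 0
  then show ?case
    by (simp add: continuous_at_imp_continuous_on differentiable_imp_continuous_within)
next
  case (Suc n)
  have "higher_differentiable_on S (\<lambda>x. frechet_derivative f (at x) v) n" for v
    by (rule Suc.IH) (use Suc.prems in simp)
  then show ?case using Suc.prems by simp
qed

lemma higher_differentiable_on_Suc_has_derivative: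
  assumes "higher_differentiable_on S f (Suc n)" "x \<in> S"
  shows "(f has_derivative frechet_derivative f (at x)) (at x)"
  using assms by (simp add: frechet_derivative_works)

lemma higher_differentiable_on_local:
  assumes "\<And>x. x \<in> S \<Longrightarrow> \<exists>U. open U \<and> x \<in> U \<and> higher_differentiable_on U f n"
  shows "higher_differentiable_on S f n"
  using assms
proof (induction n arbitrary: f)
  case 0
  have "isCont f x" if "x \<in> S" for x
    using 0[OF that] by (auto simp: continuous_on_eq_continuous_at)
  then show ?case by (simp add: continuous_at_imp_continuous_on)
next
  case (Suc n)
  have "higher_differentiable_on S (\<lambda>x. frechet_derivative f (at x) v) n" for v
    by (rule Suc.IH) (use Suc.prems in fastforce)
  moreover have "f differentiable (at x)" if "x \<in> S" for x
    using Suc.prems[OF that] by auto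
  ultimately show ?case by simp
qed

lemma higher_differentiable_on_const:
  fixes S :: "'a::real_normed_vector set" and c :: "'b::real_normed_vector"
  assumes "open S"
  shows "higher_differentiable_on S (\<lambda>_. c) n"
proof (induction n arbitrary: c)
  case (Suc n)
  show ?case
  proof (rule higher_differentiable_on_SucI[OF assms])
    show "((\<lambda>_. c) has_derivative (\<lambda>_. 0)) (at x)" for x by (rule has_derivative_const)
    show "higher_differentiable_on S (\<lambda>_. 0 :: 'b) n" by (rule Suc.IH)
  qed
qed simp

lemma higher_differentiable_on_bounded_linear:
  assumes "open S" "bounded_linear f"
  shows "higher_differentiable_on S f n"
proof (cases n)
  case 0
  then show ?thesis using assms by (simp add: linear_continuous_on)
next
  case (Suc m)
  show ?thesis
    unfolding Suc
  proof (intro higher_differentiable_on_SucI[OF \<open>open S\<close>])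
    show "(f has_derivative f) (at x)" for x
      using assms(2) by (rule bounded_linear_imp_has_derivative)
    show "higher_differentiable_on S (\<lambda>_. f v) m" for v
      using assms(1) by (rule higher_differentiable_on_const)
  qed
qed

lemma higher_differentiable_on_add:
  assumes "open S" "higher_differentiable_on S f n" "higher_differentiable_on S g n"
  shows "higher_differentiable_on S (\<lambda>x. f x + g x) n"
  using assms(2,3)
proof (induction n arbitrary: f g)
  case 0
  then show ?case by (simp add: continuous_on_add)
next
  case (Suc n)
  note D = Suc.prems[THEN higher_differentiable_on_Suc_has_derivative]
  show ?case
  proof (rule higher_differentiable_on_SucI[OF \<open>open S\<close>])
    show "((\<lambda>x. f x + g x) has_derivative
        (\<lambda>v. frechet_derivative f (at x) v + frechet_derivative g (at x) v)) (at x)" if "x \<in> S" for x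
      using D[OF that] by (rule has_derivative_add)
    show "higher_differentiable_on S
        (\<lambda>x. frechet_derivative f (at x) v + frechet_derivative g (at x) v) n" for v
      using Suc.prems by (intro Suc.IH) auto
  qed
qed

lemma higher_differentiable_on_mult:
  fixes f g :: "'a::real_normed_vector \<Rightarrow> real"
  assumes "open S" "higher_differentiable_on S f n" "higher_differentiable_on S g n"
  shows "higher_differentiable_on S (\<lambda>x. f x * g x) n"
  using assms(2,3)
proof (induction n arbitrary: f g)
  case 0
  then show ?case by (simp add: continuous_on_mult)
next
  case (Suc n)
  note D = Suc.prems[THEN higher_differentiable_on_Suc_has_derivative]
  show ?case
  proof (rule higher_differentiable_on_SucI[OF \<open>open S\<close>])
    show "((\<lambda>x. f x * g x) has_derivative
        (\<lambda>v. f x * frechet_derivative g (at x) v + frechet_derivative f (at x) v * g x)) (at x)"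
      if "x \<in> S" for x
      using D[OF that] by (rule has_derivative_mult)
    have f: "higher_differentiable_on S f n" and g: "higher_differentiable_on S g n"
      using Suc.prems[THEN higher_differentiable_on_SucD] by auto
    show "higher_differentiable_on S
        (\<lambda>x. f x * frechet_derivative g (at x) v + frechet_derivative f (at x) v * g x) n" for v
      by (rule higher_differentiable_on_add[OF \<open>open S\<close> Suc.IH[OF f] Suc.IH[OF _ g]])
        (use Suc.prems in auto)
  qed
qed

lemma higher_differentiable_on_inverse:
  fixes f :: "'a::real_normed_vector \<Rightarrow> real"
  assumes "open S" "higher_differentiable_on S f n" "\<And>x. x \<in> S \<Longrightarrow> f x \<noteq> 0"
  shows "higher_differentiable_on S (\<lambda>x. inverse (f x)) n"
  using assms(2)
proof (induction n)
  case 0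
  then show ?case using assms(3) by (simp add: continuous_on_inverse)
next
  case (Suc n)
  have inv: "higher_differentiable_on S (\<lambda>x. inverse (f x)) n"
    by (rule Suc.IH[OF higher_differentiable_on_SucD[OF Suc.prems]])
  show ?case
  proof (rule higher_differentiable_on_SucI[OF \<open>open S\<close>])
    show "((\<lambda>x. inverse (f x)) has_derivative
        (\<lambda>v. - 1 * (inverse (f x) * frechet_derivative f (at x) v * inverse (f x)))) (at x)"
      if "x \<in> S" for x
      using Deriv.has_derivative_inverse[OF assms(3)[OF that]
          higher_differentiable_on_Suc_has_derivative[OF Suc.prems that]] by simp
    show "higher_differentiable_on S
        (\<lambda>x. - 1 * (inverse (f x) * frechet_derivative f (at x) v * inverse (f x))) n" for v
      using Suc.prems
      by (intro higher_differentiable_on_mult[OF \<open>open S\<close>] higher_differentiable_on_const[OF \<open>open S\<close>] inv) auto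
  qed
qed

lemma higher_differentiable_on_ln:
  fixes f :: "'a::real_normed_vector \<Rightarrow> real"
  assumes "open S" "higher_differentiable_on S f n" "\<And>x. x \<in> S \<Longrightarrow> f x > 0"
  shows "higher_differentiable_on S (\<lambda>x. ln (f x)) n"
proof (cases n)
  case 0
  then show ?thesis using assms(2,3) by (auto intro!: continuous_on_ln simp: less_le)
next
  case (Suc m)
  have f: "higher_differentiable_on S f (Suc m)" using assms(2) Suc by blast
  have inv: "higher_differentiable_on S (\<lambda>x. inverse (f x)) m"
    using higher_differentiable_on_inverse[OF assms(1) higher_differentiable_on_SucD[OF f]] assms(3)
    by (metis less_irrefl)
  show ?thesis
    unfolding Suc
  proof (rule higher_differentiable_on_SucI[OF \<open>open S\<close>])
    show "((\<lambda>x. ln (f x)) has_derivative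
        (\<lambda>v. frechet_derivative f (at x) v * inverse (f x))) (at x)" if "x \<in> S" for x
      using has_derivative_ln[OF assms(3)[OF that] higher_differentiable_on_Suc_has_derivative[OF f that]]
      by (simp add: divide_inverse)
    show "higher_differentiable_on S (\<lambda>x. frechet_derivative f (at x) v * inverse (f x)) m" for v
      using f by (intro higher_differentiable_on_mult[OF \<open>open S\<close> _ inv]) auto
  qed
qed

lemma smooth_on_has_derivative:
  assumes "smooth_on S f" "x \<in> S"
  shows "(f has_derivative frechet_derivative f (at x)) (at x)"
  using assms higher_differentiable_on_Suc_has_derivative unfolding smooth_on_def by blast

lemma smooth_on_frechet_derivative:
  assumes "smooth_on S f"
  shows "smooth_on S (\<lambda>x. frechet_derivative f (at x) v)"
  using assms unfolding smooth_on_def by (metis higher_differentiable_on.simps(2))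

section \<open>Moment generating functions\<close>

text \<open>
  The difference of the two sides is \<open>(exp z - exp (- z))\<^sup>2 - (2 z)\<^sup>2\<close> with \<open>z = y / 2\<close>, so the
  inequality reduces to \<open>z \<le> sinh z\<close> for \<open>z \<ge> 0\<close>.
\<close>
lemma exp_plus_exp_minus_ge:
  fixes y :: real
  shows "2 + y\<^sup>2 \<le> exp y + exp (- y)"
proof -
  have sinh: "2 * z \<le> exp z - exp (- z)" if "z \<ge> 0" for z :: real
  proof -
    have e: "1 + z + z\<^sup>2 / 2 \<le> exp z" using that exp_lower_Taylor_quadratic by blast
    have "1 \<le> (1 - z + z\<^sup>2 / 2) * (1 + z + z\<^sup>2 / 2)"
      using zero_le_power2[of "z\<^sup>2"] by (simp add: algebra_simps power2_eq_square)
    also have "\<dots> \<le> (1 - z + z\<^sup>2 / 2) * exp z"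
    proof (rule mult_left_mono[OF e])
      have "0 \<le> (z - 1)\<^sup>2 + 1" by simp
      then show "0 \<le> 1 - z + z\<^sup>2 / 2" by (simp add: power2_eq_square algebra_simps)
    qed
    finally have "exp (- z) \<le> 1 - z + z\<^sup>2 / 2" by (simp add: exp_minus field_simps)
    then show ?thesis using e by linarith
  qed
  define z where "z = \<bar>y\<bar> / 2"
  have "(2 * z)\<^sup>2 \<le> (exp z - exp (- z))\<^sup>2"
    by (rule power_mono[OF sinh]) (auto simp: z_def)
  also have "\<dots> = exp (2 * z) + exp (- (2 * z)) - 2"
    by (simp add: power2_eq_square algebra_simps flip: exp_add)
  also have "\<dots> = exp y + exp (- y) - 2"
    unfolding z_def by (auto simp: abs_if)
  finally show ?thesis by (simp add: z_def)
qed

context prob_space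
begin

text \<open>
  Since \<open>1 + y \<le> exp y\<close>, the function \<open>t \<mapsto> E (exp (t Y)) - 1 - t E Y\<close> is nonnegative near
  \<open>0\<close> and vanishes at \<open>0\<close>, so its derivative there is zero.
\<close>
lemma expectation_eq_mgf_derivative:
  assumes Y[measurable]: "random_variable borel Y"
    and "\<epsilon> > 0"
    and int: "\<And>t. \<bar>t\<bar> < \<epsilon> \<Longrightarrow> integrable M (\<lambda>x. exp (t * Y x))"
    and der: "((\<lambda>t. expectation (\<lambda>x. exp (t * Y x))) has_real_derivative m) (at 0)"
  shows "integrable M Y" and "expectation Y = m"
proof -
  define s where "s = \<epsilon> / 2"
  have s: "s > 0" "\<bar>s\<bar> < \<epsilon>" "\<bar>- s\<bar> < \<epsilon>" using \<open>\<epsilon> > 0\<close> by (auto simp: s_def)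
  have "norm (Y x) \<le> norm ((exp (s * Y x) + exp (- s * Y x)) / s)" for x
  proof -
    have "2 + (s * Y x)\<^sup>2 \<le> exp (s * Y x) + exp (- s * Y x)"
      using exp_plus_exp_minus_ge[of "s * Y x"] by simp
    moreover have "0 \<le> (\<bar>s * Y x\<bar> - 1)\<^sup>2" by simp
    ultimately have "\<bar>s * Y x\<bar> \<le> exp (s * Y x) + exp (- s * Y x)"
      by (simp add: power2_diff algebra_simps)
    then show ?thesis using s(1) by (simp add: abs_mult field_simps)
  qed
  moreover have "integrable M (\<lambda>x. (exp (s * Y x) + exp (- s * Y x)) / s)"
    using int[OF s(2)] int[OF s(3)] by simp
  ultimately show i: "integrable M Y"
    using Bochner_Integration.integrable_bound[OF _ Y] by blast
  define R where "R t = expectation (\<lambda>x. exp (t * Y x)) - 1 - t * expectation Y" for t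
  have "R 0 \<le> R t" if "\<bar>0 - t\<bar> < \<epsilon>" for t
  proof -
    have "expectation (\<lambda>x. 1 + t * Y x) \<le> expectation (\<lambda>x. exp (t * Y x))"
      by (intro integral_mono) (use that int i in auto)
    moreover have "expectation (\<lambda>x. 1 + t * Y x) = 1 + t * expectation Y"
      using i by (simp add: prob_space)
    moreover have "R 0 = 0" by (simp add: R_def prob_space)
    ultimately show ?thesis by (simp add: R_def)
  qed
  moreover have "(R has_real_derivative m - expectation Y) (at 0)"
    unfolding R_def by (rule derivative_eq_intros der refl | simp)+
  ultimately have "m - expectation Y = 0"
    using DERIV_local_min \<open>\<epsilon> > 0\<close> by blast
  then show "expectation Y = m" by simp
qed

end

lemma second_derivative_nonneg_at_minimum:
  fixes f :: "real \<Rightarrow> real"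
  assumes "\<epsilon> > 0"
    and der: "\<And>t. \<bar>t\<bar> < \<epsilon> \<Longrightarrow> (f has_real_derivative f' t) (at t)"
    and der2: "(f' has_real_derivative D) (at 0)"
    and min: "\<And>t. \<bar>t\<bar> < \<epsilon> \<Longrightarrow> f 0 \<le> f t"
  shows "0 \<le> D"
proof (rule ccontr)
  assume "\<not> 0 \<le> D"
  then obtain d where d: "d > 0" "\<And>h. h > 0 \<Longrightarrow> h < d \<Longrightarrow> f' (0 + h) < f' 0"
    using DERIV_neg_dec_right[OF der2] by auto
  have "f' 0 = 0"
    using DERIV_local_min[OF der[of 0] \<open>\<epsilon> > 0\<close>] min \<open>\<epsilon> > 0\<close> by simp
  define s where "s = min d \<epsilon> / 2"
  have s: "s > 0" "s < d" "s < \<epsilon>" using d(1) \<open>\<epsilon> > 0\<close> by (auto simp: s_def min_def)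
  have "\<exists>z. z > 0 \<and> z < s \<and> f s - f 0 = (s - 0) * f' z"
    by (rule MVT2) (use s der in auto)
  then obtain z where "0 < z" "z < s" "f s - f 0 = s * f' z" by auto
  moreover have "f' z < 0" using d(2)[of z] \<open>f' 0 = 0\<close> s calculation by auto
  ultimately have "f s < f 0" using s(1) by (smt (verit) mult_pos_neg)
  then show False using min[of s] s by auto
qed

text \<open>
  Integrating \<open>(t Y)\<^sup>2 \<le> exp (t Y) + exp (- t Y) - 2\<close> shows that
  \<open>K t + K (- t) - t\<^sup>2 E Y\<^sup>2\<close> is minimal at \<open>t = 0\<close>; its second derivative there is
  \<open>2 h - 2 E Y\<^sup>2\<close>.
\<close>
lemma (in prob_space) second_moment_le_mgf_second_derivative:
  assumes Y[measurable]: "random_variable borel Y"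
    and "\<epsilon> > 0"
    and int: "\<And>t. \<bar>t\<bar> < \<epsilon> \<Longrightarrow> integrable M (\<lambda>x. exp (t * Y x))"
    and K: "\<And>t. \<bar>t\<bar> < \<epsilon> \<Longrightarrow> expectation (\<lambda>x. exp (t * Y x)) = K t"
    and der: "\<And>t. \<bar>t\<bar> < \<epsilon> \<Longrightarrow> (K has_real_derivative K' t) (at t)"
    and der2: "(K' has_real_derivative h) (at 0)"
  shows "integrable M (\<lambda>x. (Y x)\<^sup>2)" and "expectation (\<lambda>x. (Y x)\<^sup>2) \<le> h"
proof -
  have bound: "(t * Y x)\<^sup>2 \<le> exp (t * Y x) + exp (- t * Y x) - 2" for t x
    using exp_plus_exp_minus_ge[of "t * Y x"] by simp
  define s where "s = \<epsilon> / 2"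
  have s: "s > 0" "\<bar>s\<bar> < \<epsilon>" "\<bar>- s\<bar> < \<epsilon>" using \<open>\<epsilon> > 0\<close> by (auto simp: s_def)
  have "norm ((Y x)\<^sup>2) \<le> norm ((exp (s * Y x) + exp (- s * Y x) - 2) / s\<^sup>2)" for x
  proof -
    have "(Y x)\<^sup>2 \<le> (exp (s * Y x) + exp (- s * Y x) - 2) / s\<^sup>2"
      using bound[of s x] s(1) by (simp add: field_simps power_mult_distrib)
    then show ?thesis
      using zero_le_power2[of "Y x"] by (simp only: real_norm_def)
  qed
  moreover have "integrable M (\<lambda>x. (exp (s * Y x) + exp (- s * Y x) - 2) / s\<^sup>2)"
    using int[OF s(2)] int[OF s(3)] by simp
  ultimately show i: "integrable M (\<lambda>x. (Y x)\<^sup>2)"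
    by (intro Bochner_Integration.integrable_bound[of M _ "\<lambda>x. (Y x)\<^sup>2"]) auto
  define w where "w = expectation (\<lambda>x. (Y x)\<^sup>2)"
  define R where "R t = K t + K (- t) - t\<^sup>2 * w" for t
  have "0 \<le> 2 * h - 2 * w"
  proof (rule second_derivative_nonneg_at_minimum[OF \<open>\<epsilon> > 0\<close>, where f = R])
    show "(R has_real_derivative K' t - K' (- t) - 2 * t * w) (at t)" if "\<bar>t\<bar> < \<epsilon>" for t
    proof -
      have "((\<lambda>t. K (- t)) has_real_derivative - K' (- t)) (at t)"
        using der[of "- t"] that by (simp flip: DERIV_mirror)
      then show ?thesis
        unfolding R_def using der[OF that] by (auto intro!: derivative_eq_intros)
    qed
    have "((\<lambda>t. K' (- t)) has_real_derivative - h) (at 0)"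
      using der2 DERIV_mirror[of K' h 0] by simp
    then show "((\<lambda>t. K' t - K' (- t) - 2 * t * w) has_real_derivative 2 * h - 2 * w) (at 0)"
      using der2 by (auto intro!: derivative_eq_intros)
    show "R 0 \<le> R t" if "\<bar>t\<bar> < \<epsilon>" for t
    proof -
      have t': "\<bar>- t\<bar> < \<epsilon>" using that by simp
      have "expectation (\<lambda>x. (t * Y x)\<^sup>2) \<le> expectation (\<lambda>x. exp (t * Y x) + exp (- t * Y x) - 2)"
        using int[OF that] int[OF t'] i
        by (intro integral_mono bound) (auto simp: power_mult_distrib)
      also have "\<dots> = K t + K (- t) - 2"
        using int[OF that] int[OF t'] K[OF that] K[OF t'] by (simp add: prob_space)
      finally have "t\<^sup>2 * w \<le> K t + K (- t) - 2" by (simp add: power_mult_distrib w_def)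
      moreover have "K 0 = 1" using K[of 0] \<open>\<epsilon> > 0\<close> by (simp add: prob_space)
      ultimately show ?thesis by (simp add: R_def)
    qed
  qed
  then show "expectation (\<lambda>x. (Y x)\<^sup>2) \<le> h" by (simp add: w_def)
qed

section \<open>Determinants, lines and partial derivatives\<close>

text \<open>
  On the segment from the identity to \<open>A\<close> all matrices are positive definite, hence regular, so the
  determinant keeps the sign that it has at the identity.
\<close>
lemma det_pos_if_positive_definite:
  fixes A :: "real ^ 'n ^ 'n"
  assumes pd: "\<And>v. v \<noteq> 0 \<Longrightarrow> 0 < v \<bullet> (A *v v)"
  shows "0 < det A"
proof (rule ccontr)
  assume "\<not> 0 < det A"
  define B where "B t = (1 - t) *\<^sub>R mat 1 + t *\<^sub>R A" for t
  have "continuous_on {0..1} (\<lambda>t. det (B t))"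
    unfolding det_def B_def by (auto intro!: continuous_intros)
  moreover have "det (B 1) \<le> 0" "0 \<le> det (B 0)" using \<open>\<not> 0 < det A\<close> by (auto simp: B_def)
  ultimately obtain t where t: "0 \<le> t" "t \<le> 1" "det (B t) = 0"
    using IVT2'[of "\<lambda>t. det (B t)" 1 0 0] by auto
  then obtain v where v: "v \<noteq> 0" "B t *v v = 0"
    using invertible_det_nz[of "B t"] invertible_left_inverse[of "B t"] matrix_left_invertible_ker[of "B t"] by blast
  have "B t *v v = (1 - t) *\<^sub>R v + t *\<^sub>R (A *v v)"
    by (simp add: B_def matrix_vector_mult_add_rdistrib scaleR_matrix_vector_assoc flip: scaleR_matrix_vector_assoc)
  then have "0 = (1 - t) * (v \<bullet> v) + t * (v \<bullet> (A *v v))"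
    using v(2) by (metis inner_add_right inner_scaleR_right inner_zero_right)
  moreover have "0 < (1 - t) * (v \<bullet> v) + t * (v \<bullet> (A *v v))"
  proof (cases "t = 0")
    case False
    then show ?thesis using t(1,2) v(1) pd[OF v(1)] by (intro add_nonneg_pos) auto
  qed (use v(1) in simp)
  ultimately show False by simp
qed

lemma differentiable_prod:
  fixes f :: "'i \<Rightarrow> 'a::real_normed_vector \<Rightarrow> real"
  assumes "\<And>i. i \<in> A \<Longrightarrow> f i differentiable (at x)"
  shows "(\<lambda>x. \<Prod>i\<in>A. f i x) differentiable (at x)"
  using assms by (induction A rule: infinite_finite_induct) simp_all

lemma has_derivative_vec_lambda:
  fixes f :: "'n::finite \<Rightarrow> 'a::euclidean_space \<Rightarrow> real"
  assumes "\<And>i. (f i has_derivative f' i) (at x)"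
  shows "((\<lambda>x. \<chi> i. f i x) has_derivative (\<lambda>h. \<chi> i. f' i h)) (at x)"
proof (rule has_derivative_componentwise_within[THEN iffD2], rule ballI)
  fix b :: "real ^ 'n"
  assume "b \<in> Basis"
  then obtain i where b: "b = axis i 1" by (auto simp: Basis_vec_def)
  show "((\<lambda>x. (\<chi> i. f i x) \<bullet> b) has_derivative (\<lambda>h. (\<chi> i. f' i h) \<bullet> b)) (at x)"
    using assms[of i] by (simp add: b inner_axis)
qed

lemma has_real_derivative_along_line:
  fixes f :: "'a::real_normed_vector \<Rightarrow> real"
  assumes "(f has_derivative f') (at (z + t *\<^sub>R v))"
  shows "((\<lambda>t. f (z + t *\<^sub>R v)) has_real_derivative f' v) (at t)"
proof -
  have "((\<lambda>t. z + t *\<^sub>R v) has_derivative (\<lambda>h. h *\<^sub>R v)) (at t)"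
    by (auto intro!: derivative_eq_intros)
  from has_derivative_compose[OF this assms]
  have "((\<lambda>t. f (z + t *\<^sub>R v)) has_derivative (\<lambda>h. f' (h *\<^sub>R v))) (at t)" .
  moreover have "f' (h *\<^sub>R v) = f' v * h" for h
    using linear_scale[OF has_derivative_linear[OF assms]] by simp
  ultimately show ?thesis by (simp add: has_field_derivative_def)
qed

text \<open>
  Through this identity \<open>eta\<close> and \<open>g_theta\<close>, which are defined by partial derivatives in
  \<open>\<theta>\<close>, inherit the joint smoothness of \<open>\<psi>\<close>.
\<close>
lemma partial_eq_derivative:
  fixes f :: "(real ^ 'd::finite) \<times> real \<Rightarrow> real"
  assumes "(f has_derivative f') (at (\<theta>, \<gamma>))"
  shows "partial i (\<lambda>\<theta>'. f (\<theta>', \<gamma>)) \<theta> = f' (axis i 1, 0)"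
  using has_real_derivative_along_line[of f f' "(\<theta>, \<gamma>)" 0 "(axis i 1, 0)"] assms
  unfolding partial_def by (intro DERIV_imp_deriv) simp

lemma partial_cong_open:
  assumes "open S" "\<theta> \<in> S" "\<And>\<theta>'. \<theta>' \<in> S \<Longrightarrow> f \<theta>' = g \<theta>'"
  shows "partial i f \<theta> = partial i g \<theta>"
  unfolding partial_def
proof (rule deriv_cong_ev[OF _ refl])
  have "((\<lambda>t. \<theta> + t *\<^sub>R axis i 1) \<longlongrightarrow> \<theta> + 0 *\<^sub>R axis i 1) (nhds (0::real))"
    by (intro tendsto_intros filterlim_ident)
  then have "\<forall>\<^sub>F t in nhds 0. \<theta> + t *\<^sub>R axis i 1 \<in> S"
    using assms(1,2) by (simp add: topological_tendstoD)
  then show "\<forall>\<^sub>F t in nhds 0. f (\<theta> + t *\<^sub>R axis i 1) = g (\<theta> + t *\<^sub>R axis i 1)"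
    by eventually_elim (rule assms(3))
qed

lemma linear_on_first_component:
  fixes f' :: "(real ^ 'd::finite) \<times> real \<Rightarrow> real"
  assumes "linear f'"
  shows "f' (v, 0) = (\<Sum>i\<in>UNIV. v $ i * f' (axis i 1, 0))"
proof -
  have "(\<Sum>i\<in>UNIV. v $ i *\<^sub>R (axis i 1 :: real ^ 'd)) = v"
    using basis_expansion[of v] by (simp only: scalar_mult_eq_scaleR)
  then have expand: "(v, 0) = (\<Sum>i\<in>UNIV. v $ i *\<^sub>R (axis i 1 :: real ^ 'd, 0::real))"
    by (intro prod_eqI) (simp_all add: fst_sum snd_sum)
  have "f' (v, 0) = (\<Sum>i\<in>UNIV. f' (v $ i *\<^sub>R (axis i 1, 0)))"
    unfolding expand by (rule linear_sum[OF assms])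
  then show ?thesis by (simp only: linear_scale[OF assms] real_scaleR_def)
qed

lemma differentiable_transform_on_open:
  assumes "f differentiable (at x)" "open U" "x \<in> U" "\<And>y. y \<in> U \<Longrightarrow> f y = g y"
  shows "g differentiable (at x)"
  using assms has_derivative_transform_within_open unfolding differentiable_def by blast

section \<open>Smoothness of the log-normalizer\<close>

context oTEF_data
begin

definition psi_pair :: "(real ^ 'd) \<times> real \<Rightarrow> real" where
  "psi_pair z = \<psi> (fst z) (snd z)"

definition dpsi :: "'d \<Rightarrow> (real ^ 'd) \<times> real \<Rightarrow> real" where
  "dpsi j z = frechet_derivative psi_pair (at z) (axis j 1, 0)"

definition ddpsi :: "'d \<Rightarrow> 'd \<Rightarrow> (real ^ 'd) \<times> real \<Rightarrow> real" where
  "ddpsi i j z = frechet_derivative (dpsi j) (at z) (axis i 1, 0)"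

definition support :: "real \<Rightarrow> real set" where
  "support \<gamma> = {y. \<gamma> \<le> y \<and> ereal y < I2}"

text \<open>
  The log-likelihood ratio of two members of the family is this statistic up to a constant.  The cut-off
  makes it Borel measurable, because \<open>F\<close> is arbitrary outside \<open>I\<close>.
\<close>
definition stat :: "real ^ 'd \<Rightarrow> real \<Rightarrow> real" where
  "stat v x = indicator I x * (\<Sum>i\<in>UNIV. v $ i * F i x)"

lemma support_sets [measurable]: "support \<gamma> \<in> sets borel"
  unfolding support_def by measurable

lemma support_subset_I:
  assumes "\<gamma> \<in> I"
  shows "support \<gamma> \<subseteq> I"
proof
  fix x
  assume "x \<in> support \<gamma>"
  then have x: "ereal \<gamma> \<le> ereal x" "ereal x < I2" by (simp_all add: support_def)
  have "I1 < ereal \<gamma>" using assms by (simp add: I_def einterval_def)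
  then have "I1 < ereal x" using x(1) by (rule less_le_trans)
  then show "x \<in> I" using x(2) by (simp add: I_def einterval_def)
qed

lemma p_eq: "p x \<theta> \<gamma> = q x \<theta> * exp (- \<psi> \<theta> \<gamma>) * indicator (support \<gamma>) x"
  by (simp add: p_def support_def)

lemma p_nonneg: "0 \<le> p x \<theta> \<gamma>"
  by (simp add: p_def q_def)

lemma ln_p: "x \<in> support \<gamma> \<Longrightarrow> ln (p x \<theta> \<gamma>) = (\<Sum>i\<in>UNIV. \<theta> $ i * F i x) + M x - \<psi> \<theta> \<gamma>"
  by (simp add: p_eq q_def flip: exp_add)

lemma stat_scaleR: "stat (t *\<^sub>R v) x = t * stat v x"
  by (simp add: stat_def sum_distrib_left mult.assoc mult.left_commute)

lemma p_change:
  assumes "\<gamma> \<in> I"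
  shows "p x \<theta>2 \<gamma> = p x \<theta>1 \<gamma> * exp (stat (\<theta>2 - \<theta>1) x - (\<psi> \<theta>2 \<gamma> - \<psi> \<theta>1 \<gamma>))"
proof (cases "x \<in> support \<gamma>")
  case True
  then have "x \<in> I" using support_subset_I[OF assms] by blast
  have "(\<Sum>i\<in>UNIV. \<theta>2 $ i * F i x) = (\<Sum>i\<in>UNIV. \<theta>1 $ i * F i x) + stat (\<theta>2 - \<theta>1) x"
    using \<open>x \<in> I\<close> by (simp add: stat_def left_diff_distrib sum_subtractf)
  then show ?thesis using True by (simp add: p_eq q_def algebra_simps flip: exp_add)
qed (simp add: p_eq)

lemma space_P [simp]: "space (P \<theta> \<gamma>) = UNIV" and sets_P [simp, measurable_cong]: "sets (P \<theta> \<gamma>) = sets borel"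
  by (simp_all add: P_def)

end

context oTEF
begin

lemma open_I: "open I"
  by (simp add: I_def)

lemma open_parameters: "open (\<Theta> \<times> I)"
  using open_Theta open_I by (rule open_Times)

lemma continuous_on_F: "continuous_on I (F i)"
  using smooth_F[of i] unfolding smooth_on_def by (metis higher_differentiable_on.simps(1))

lemma continuous_on_q: "continuous_on I (\<lambda>x. q x \<theta>)"
  unfolding q_def by (intro continuous_intros continuous_on_F cont_M)

lemma p_measurable [measurable]:
  assumes "\<gamma> \<in> I"
  shows "(\<lambda>x. p x \<theta> \<gamma>) \<in> borel_measurable borel"
proof -
  have "(\<lambda>x. indicator (support \<gamma>) x *\<^sub>R (q x \<theta> * exp (- \<psi> \<theta> \<gamma>))) \<in> borel_measurable borel"
    using continuous_on_subset[OF continuous_on_q support_subset_I[OF assms]]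
    by (intro borel_measurable_continuous_on_indicator support_sets continuous_intros)
  then show ?thesis by (simp add: p_eq mult.commute)
qed

lemma stat_measurable [measurable]: "stat v \<in> borel_measurable borel"
proof -
  have "(\<lambda>x. indicator I x *\<^sub>R (\<Sum>i\<in>UNIV. v $ i * F i x)) \<in> borel_measurable borel"
    using open_I by (intro borel_measurable_continuous_on_indicator continuous_intros continuous_on_F) simp
  then show ?thesis by (simp add: stat_def[abs_def])
qed

lemma exists_greater_in_I:
  assumes "\<gamma> \<in> I"
  obtains x where "x \<in> I" "\<gamma> < x"
proof -
  have "ereal \<gamma> < I2" "I1 < ereal \<gamma>" using assms by (auto simp: I_def einterval_def)
  then obtain x where "ereal \<gamma> < ereal x" "ereal x < I2" using ereal_dense2 by blast
  moreover have "I1 < ereal x" using \<open>I1 < ereal \<gamma>\<close> \<open>ereal \<gamma> < ereal x\<close> by (rule less_trans)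
  ultimately have "x \<in> I" "\<gamma> < x" by (simp_all add: I_def einterval_def)
  then show ?thesis by (rule that)
qed

lemma bounded_linear_natural_pairing:
  "bounded_linear (\<lambda>z :: (real ^ 'd) \<times> real. \<Sum>i\<in>UNIV. fst z $ i * F i x)"
  unfolding linear_conv_bounded_linear[symmetric]
  by (rule linearI) (simp_all add: sum.distrib distrib_right sum_distrib_left mult.assoc)

text \<open>
  Smoothness is assumed of the density, for each fixed sample point \<open>x\<close> and only while
  \<open>\<gamma> < x\<close>.  Near a given \<open>(\<theta>, \<gamma>)\<close> a sample point slightly larger than \<open>\<gamma>\<close> is
  available, and there \<open>\<psi> \<theta> \<gamma> = (\<Sum>i. \<theta>\<^sub>i F\<^sub>i x) + M x - ln (p x \<theta> \<gamma>)\<close>.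
\<close>
lemma smooth_psi: "smooth_on (\<Theta> \<times> I) psi_pair"
  unfolding smooth_on_def
proof (rule allI, rule higher_differentiable_on_local)
  fix n z
  assume "z \<in> \<Theta> \<times> I"
  then have "snd z \<in> I" by auto
  then obtain x where x: "x \<in> I" "snd z < x" by (rule exists_greater_in_I)
  define U where "U = \<Theta> \<times> {\<gamma>\<in>I. \<gamma> < x}"
  have "{\<gamma>\<in>I. \<gamma> < x} = I \<inter> {..<x}" by auto
  then have "open U" unfolding U_def using open_Theta open_I by (simp add: open_Times open_Int)
  have x_support: "x \<in> support (snd w)" if "w \<in> U" for w
    using that x(1) by (auto simp: U_def support_def I_def einterval_def)
  define lin where "lin w = (\<Sum>i\<in>UNIV. fst w $ i * F i x)" for w :: "(real ^ 'd) \<times> real"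
  have lin: "higher_differentiable_on U lin n"
    unfolding lin_def
    using \<open>open U\<close> bounded_linear_natural_pairing by (rule higher_differentiable_on_bounded_linear)
  have pU: "higher_differentiable_on U (\<lambda>(\<theta>, \<gamma>). p x \<theta> \<gamma>) n"
    using smooth_p[OF x(1)] unfolding U_def smooth_on_def by blast
  have "(case w of (\<theta>, \<gamma>) \<Rightarrow> p x \<theta> \<gamma>) > 0" if "w \<in> U" for w
    using x_support[OF that] by (auto simp: p_eq q_def split: prod.splits)
  note ln = higher_differentiable_on_ln[OF \<open>open U\<close> pU this]
  have "higher_differentiable_on U (\<lambda>w. (lin w + M x) + (- 1) * ln (case w of (\<theta>, \<gamma>) \<Rightarrow> p x \<theta> \<gamma>)) n"
    by (rule higher_differentiable_on_add[OF \<open>open U\<close>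
          higher_differentiable_on_add[OF \<open>open U\<close> lin higher_differentiable_on_const[OF \<open>open U\<close>]]
          higher_differentiable_on_mult[OF \<open>open U\<close> higher_differentiable_on_const[OF \<open>open U\<close>] ln]])
  moreover have "(lin w + M x) + (- 1) * ln (case w of (\<theta>, \<gamma>) \<Rightarrow> p x \<theta> \<gamma>) = psi_pair w" if "w \<in> U" for w
    using ln_p[OF x_support[OF that]] by (simp add: lin_def psi_pair_def case_prod_beta)
  ultimately have "higher_differentiable_on U psi_pair n"
    by (rule higher_differentiable_on_cong[OF \<open>open U\<close>, rotated])
  moreover have "z \<in> U" using \<open>z \<in> \<Theta> \<times> I\<close> x by (auto simp: U_def)
  ultimately show "\<exists>U. open U \<and> z \<in> U \<and> higher_differentiable_on U psi_pair n"
    using \<open>open U\<close> by blast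
qed

lemma psi_derivative:
  assumes "z \<in> \<Theta> \<times> I"
  shows "(psi_pair has_derivative frechet_derivative psi_pair (at z)) (at z)"
  using smooth_psi assms by (rule smooth_on_has_derivative)

lemma smooth_dpsi: "smooth_on (\<Theta> \<times> I) (dpsi j)"
  using smooth_on_frechet_derivative[OF smooth_psi] by (simp add: dpsi_def[abs_def])

lemma dpsi_derivative:
  assumes "z \<in> \<Theta> \<times> I"
  shows "(dpsi j has_derivative frechet_derivative (dpsi j) (at z)) (at z)"
  using smooth_dpsi assms by (rule smooth_on_has_derivative)

lemma eta_eq:
  assumes "\<theta> \<in> \<Theta>" "\<gamma> \<in> I"
  shows "eta \<theta> \<gamma> = (\<chi> j. dpsi j (\<theta>, \<gamma>))"
  using partial_eq_derivative[OF psi_derivative] assms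
  by (simp add: eta_def dpsi_def psi_pair_def[symmetric]  vec_eq_iff) (simp add: psi_pair_def)

lemma AE_P_support:
  assumes "\<theta> \<in> \<Theta>" "\<gamma> \<in> I"
  shows "AE x in P \<theta> \<gamma>. x \<in> support \<gamma>"
proof -
  have "(\<lambda>x. ennreal (p x \<theta> \<gamma>)) \<in> borel_measurable lborel" using assms(2) by measurable
  moreover have "x \<in> support \<gamma>" if "0 < ennreal (p x \<theta> \<gamma>)" for x
    using that by (cases "x \<in> support \<gamma>") (auto simp: p_eq)
  ultimately show ?thesis unfolding P_def by (simp add: AE_density)
qed

text \<open>
  On the support, the second derivatives of the log-density in \<open>\<theta>\<close> do not depend on the sample
  point.  Off the support the density is constantly \<open>0\<close>, and \<open>ln 0 = 0\<close> makes the integrand vanish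
  on a null set.
\<close>
lemma g_theta_eq:
  assumes "\<theta> \<in> \<Theta>" "\<gamma> \<in> I"
  shows "g_theta \<theta> \<gamma> $ i $ j = ddpsi i j (\<theta>, \<gamma>)"
proof -
  interpret N: prob_space "P \<theta> \<gamma>" using assms by (rule prob)
  have first: "partial j (\<lambda>\<theta>'. ln (p x \<theta>' \<gamma>)) \<theta>' = F j x - dpsi j (\<theta>', \<gamma>)"
    if "x \<in> support \<gamma>" "\<theta>' \<in> \<Theta>" for x \<theta>'
  proof -
    define f where "f z = (\<Sum>i\<in>UNIV. fst z $ i * F i x) + M x - psi_pair z" for z :: "(real ^ 'd) \<times> real"
    have "(f has_derivative (\<lambda>h. (\<Sum>i\<in>UNIV. fst h $ i * F i x) - frechet_derivative psi_pair (at (\<theta>', \<gamma>)) h))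
        (at (\<theta>', \<gamma>))"
      unfolding f_def using psi_derivative[of "(\<theta>', \<gamma>)"] that assms
        bounded_linear_imp_has_derivative[OF bounded_linear_natural_pairing]
      by (auto intro!: has_derivative_diff has_derivative_add_const)
    from partial_eq_derivative[OF this, of j] show ?thesis
      using that(1) by (simp add: f_def ln_p psi_pair_def dpsi_def axis_def if_distrib[of "\<lambda>c. c * _"] cong: if_cong)
  qed
  have second: "partial i (partial j (\<lambda>\<theta>'. ln (p x \<theta>' \<gamma>))) \<theta> = - ddpsi i j (\<theta>, \<gamma>)"
    if "x \<in> support \<gamma>" for x
  proof -
    have "partial i (partial j (\<lambda>\<theta>'. ln (p x \<theta>' \<gamma>))) \<theta> = partial i (\<lambda>\<theta>'. F j x - dpsi j (\<theta>', \<gamma>)) \<theta>"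
      using first[OF that] by (rule partial_cong_open[OF open_Theta assms(1)])
    also have "\<dots> = - ddpsi i j (\<theta>, \<gamma>)"
    proof -
      have "((\<lambda>z. F j x - dpsi j z) has_derivative (\<lambda>h. - frechet_derivative (dpsi j) (at (\<theta>, \<gamma>)) h)) (at (\<theta>, \<gamma>))"
        using dpsi_derivative[of "(\<theta>, \<gamma>)"] assms by (auto intro!: derivative_eq_intros)
      from partial_eq_derivative[OF this] show ?thesis by (simp add: ddpsi_def)
    qed
    finally show ?thesis .
  qed
  have outside: "partial i (partial j (\<lambda>\<theta>'. ln (p x \<theta>' \<gamma>))) \<theta> = 0" if "x \<notin> support \<gamma>" for x
    using that by (simp add: p_eq partial_def)
  have "(\<integral>x. partial i (partial j (\<lambda>\<theta>'. ln (p x \<theta>' \<gamma>))) \<theta> \<partial>P \<theta> \<gamma>)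
      = (\<integral>x. - ddpsi i j (\<theta>, \<gamma>) * indicator (support \<gamma>) x \<partial>P \<theta> \<gamma>)"
    by (rule Bochner_Integration.integral_cong) (auto simp: second outside indicator_def)
  also have "\<dots> = - ddpsi i j (\<theta>, \<gamma>)"
    using AE_P_support[OF assms] by (simp add: N.prob_eq_1)
  finally show ?thesis by (simp add: g_theta_def)
qed

section \<open>Strict convexity of the log-normalizer\<close>

lemma P_change:
  assumes "\<gamma> \<in> I"
  shows "P \<theta>2 \<gamma> = density (P \<theta>1 \<gamma>) (\<lambda>x. ennreal (exp (stat (\<theta>2 - \<theta>1) x - (\<psi> \<theta>2 \<gamma> - \<psi> \<theta>1 \<gamma>))))"
  unfolding P_def using assms
  by (subst density_density_eq)
    (auto simp: p_change[OF assms, of _ \<theta>2 \<theta>1] p_nonneg ennreal_mult intro!: density_cong)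

text \<open>
  The density of \<open>P \<theta>2 \<gamma>\<close> with respect to \<open>P \<theta>1 \<gamma>\<close> has integral \<open>1\<close>.  With
  \<open>\<theta>2 = \<theta>1 + t v\<close> this is the moment generating function of the statistic in direction
  \<open>v\<close>, for the \<open>t\<close> that keep the parameter in \<open>\<Theta>\<close>.
\<close>
lemma exp_moment:
  assumes "\<theta>1 \<in> \<Theta>" "\<theta>2 \<in> \<Theta>" "\<gamma> \<in> I"
  shows "integrable (P \<theta>1 \<gamma>) (\<lambda>x. exp (stat (\<theta>2 - \<theta>1) x))"
    and "(\<integral>x. exp (stat (\<theta>2 - \<theta>1) x) \<partial>P \<theta>1 \<gamma>) = exp (\<psi> \<theta>2 \<gamma> - \<psi> \<theta>1 \<gamma>)"
proof -
  interpret N: prob_space "P \<theta>2 \<gamma>" using assms(2,3) by (rule prob)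
  define c where "c = \<psi> \<theta>2 \<gamma> - \<psi> \<theta>1 \<gamma>"
  have "emeasure (P \<theta>2 \<gamma>) UNIV = (\<integral>\<^sup>+x. ennreal (exp (stat (\<theta>2 - \<theta>1) x - c)) \<partial>P \<theta>1 \<gamma>)"
    by (subst P_change[OF assms(3), of \<theta>2 \<theta>1]) (simp add: emeasure_density c_def)
  then have "(\<integral>\<^sup>+x. ennreal (exp (stat (\<theta>2 - \<theta>1) x - c)) \<partial>P \<theta>1 \<gamma>) = ennreal 1"
    using N.emeasure_space_1 by simp
  then have *: "integrable (P \<theta>1 \<gamma>) (\<lambda>x. exp (stat (\<theta>2 - \<theta>1) x - c))"
    "(\<integral>x. exp (stat (\<theta>2 - \<theta>1) x - c) \<partial>P \<theta>1 \<gamma>) = 1"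
    using nn_integral_eq_integrable[of "\<lambda>x. exp (stat (\<theta>2 - \<theta>1) x - c)" "P \<theta>1 \<gamma>" 1] by auto
  have e: "exp (stat (\<theta>2 - \<theta>1) x) = exp c * exp (stat (\<theta>2 - \<theta>1) x - c)" for x
    by (simp flip: exp_add)
  show "integrable (P \<theta>1 \<gamma>) (\<lambda>x. exp (stat (\<theta>2 - \<theta>1) x))"
    "(\<integral>x. exp (stat (\<theta>2 - \<theta>1) x) \<partial>P \<theta>1 \<gamma>) = exp (\<psi> \<theta>2 \<gamma> - \<psi> \<theta>1 \<gamma>)"
    unfolding e using * by (simp_all add: c_def)
qed

text \<open>
  This is where identifiability enters: if the log-likelihood ratio is constant, the constant is
  \<open>0\<close> because both measures have total mass \<open>1\<close>, and the measures coincide.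
\<close>
lemma eq_if_stat_AE_const:
  assumes "\<theta>1 \<in> \<Theta>" "\<theta>2 \<in> \<Theta>" "\<gamma> \<in> I" and ae: "AE x in P \<theta>1 \<gamma>. stat (\<theta>2 - \<theta>1) x = c"
  shows "\<theta>1 = \<theta>2"
proof -
  interpret N: prob_space "P \<theta>1 \<gamma>" using assms(1,3) by (rule prob)
  have "exp (\<psi> \<theta>2 \<gamma> - \<psi> \<theta>1 \<gamma>) = (\<integral>x. exp (stat (\<theta>2 - \<theta>1) x) \<partial>P \<theta>1 \<gamma>)"
    using exp_moment(2)[OF assms(1-3)] by simp
  also have "\<dots> = (\<integral>x. exp c \<partial>P \<theta>1 \<gamma>)"
    by (rule integral_cong_AE) (use ae in \<open>auto\<close>)
  also have "\<dots> = exp c" by (simp add: N.prob_space[simplified])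
  finally have c: "\<psi> \<theta>2 \<gamma> - \<psi> \<theta>1 \<gamma> = c" by simp
  have "P \<theta>2 \<gamma> = density (P \<theta>1 \<gamma>) (\<lambda>_. 1)"
    unfolding P_change[OF assms(3), of \<theta>2 \<theta>1] c
    by (rule density_cong) (use ae in auto)
  then show ?thesis
    using identifiable[OF assms(1-3)] by (simp add: density_1)
qed

lemma segment_in_Theta:
  assumes "\<theta> \<in> \<Theta>"
  obtains \<epsilon> where "\<epsilon> > 0" "\<And>t. \<bar>t\<bar> < \<epsilon> \<Longrightarrow> \<theta> + t *\<^sub>R v \<in> \<Theta>"
proof -
  obtain e where e: "e > 0" "ball \<theta> e \<subseteq> \<Theta>"
    using open_Theta assms open_contains_ball by blast
  have "\<theta> + t *\<^sub>R v \<in> \<Theta>" if "\<bar>t\<bar> < e / (norm v + 1)" for t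
  proof -
    have "\<bar>t\<bar> * norm v \<le> \<bar>t\<bar> * (norm v + 1)" by (intro mult_left_mono) auto
    also have "\<dots> < e" using that by (subst (asm) pos_less_divide_eq) (simp_all add: add_nonneg_pos)
    finally show ?thesis using e(2) by (auto simp: dist_norm)
  qed
  then show ?thesis using that[of "e / (norm v + 1)"] e(1) by (simp add: add_nonneg_pos)
qed

lemma psi_along_line:
  assumes "\<theta> + t *\<^sub>R v \<in> \<Theta>" "\<gamma> \<in> I"
  shows "((\<lambda>t. \<psi> (\<theta> + t *\<^sub>R v) \<gamma>) has_real_derivative (\<Sum>j\<in>UNIV. v $ j * dpsi j (\<theta> + t *\<^sub>R v, \<gamma>))) (at t)"
proof -
  have D: "(psi_pair has_derivative frechet_derivative psi_pair (at (\<theta> + t *\<^sub>R v, \<gamma>))) (at (\<theta> + t *\<^sub>R v, \<gamma>))"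
    using psi_derivative assms by blast
  have "(psi_pair has_derivative frechet_derivative psi_pair (at (\<theta> + t *\<^sub>R v, \<gamma>))) (at ((\<theta>, \<gamma>) + t *\<^sub>R (v, 0)))"
    using D by simp
  from has_real_derivative_along_line[OF this] show ?thesis
    using linear_on_first_component[OF has_derivative_linear[OF D], of v]
    by (simp add: psi_pair_def dpsi_def)
qed

lemma dpsi_along_line:
  assumes "\<theta> \<in> \<Theta>" "\<gamma> \<in> I"
  shows "((\<lambda>t. dpsi j (\<theta> + t *\<^sub>R v, \<gamma>)) has_real_derivative (\<Sum>i\<in>UNIV. v $ i * ddpsi i j (\<theta>, \<gamma>))) (at 0)"
proof -
  have D: "(dpsi j has_derivative frechet_derivative (dpsi j) (at (\<theta>, \<gamma>))) (at (\<theta>, \<gamma>))"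
    using dpsi_derivative assms by blast
  have "(dpsi j has_derivative frechet_derivative (dpsi j) (at (\<theta>, \<gamma>))) (at ((\<theta>, \<gamma>) + 0 *\<^sub>R (v, 0)))"
    using D by simp
  from has_real_derivative_along_line[OF this] show ?thesis
    using linear_on_first_component[OF has_derivative_linear[OF D], of v]
    by (simp add: ddpsi_def)
qed

lemma expectation_stat:
  assumes "\<theta> \<in> \<Theta>" "\<gamma> \<in> I"
  shows "integrable (P \<theta> \<gamma>) (stat v)" and "(\<integral>x. stat v x \<partial>P \<theta> \<gamma>) = v \<bullet> eta \<theta> \<gamma>"
proof -
  interpret N: prob_space "P \<theta> \<gamma>" using assms by (rule prob)
  obtain \<epsilon> where \<epsilon>: "\<epsilon> > 0" "\<And>t. \<bar>t\<bar> < \<epsilon> \<Longrightarrow> \<theta> + t *\<^sub>R v \<in> \<Theta>"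
    using segment_in_Theta[OF assms(1)] by blast
  have mgf: "integrable (P \<theta> \<gamma>) (\<lambda>x. exp (t * stat v x))"
    "N.expectation (\<lambda>x. exp (t * stat v x)) = exp (\<psi> (\<theta> + t *\<^sub>R v) \<gamma> - \<psi> \<theta> \<gamma>)" if "\<bar>t\<bar> < \<epsilon>" for t
    using exp_moment[OF assms(1) \<epsilon>(2)[OF that] assms(2)] by (simp_all add: stat_scaleR)
  have "((\<lambda>t. exp (\<psi> (\<theta> + t *\<^sub>R v) \<gamma> - \<psi> \<theta> \<gamma>)) has_real_derivative v \<bullet> eta \<theta> \<gamma>) (at 0)"
    using psi_along_line[of \<theta> 0 v \<gamma>] assms
    by (auto intro!: derivative_eq_intros simp: eta_eq inner_vec_def)
  then have "((\<lambda>t. N.expectation (\<lambda>x. exp (t * stat v x))) has_real_derivative v \<bullet> eta \<theta> \<gamma>) (at 0)"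
    by (rule has_field_derivative_transform_within_open[where S = "{-\<epsilon><..<\<epsilon>}"])
      (use \<epsilon>(1) in \<open>auto simp: mgf\<close>)
  then show "integrable (P \<theta> \<gamma>) (stat v)" "(\<integral>x. stat v x \<partial>P \<theta> \<gamma>) = v \<bullet> eta \<theta> \<gamma>"
    using N.expectation_eq_mgf_derivative[of "stat v" \<epsilon>] \<epsilon>(1) mgf(1) by auto
qed

text \<open>
  The quadratic form of the Hessian bounds from above the variance of the statistic in direction
  \<open>v\<close>, and that variance is positive unless two distinct parameters give the same measure.
\<close>
lemma hessian_pos:
  assumes "\<theta> \<in> \<Theta>" "\<gamma> \<in> I" "v \<noteq> 0"
  shows "0 < (\<Sum>j\<in>UNIV. v $ j * (\<Sum>i\<in>UNIV. v $ i * ddpsi i j (\<theta>, \<gamma>)))" (is "0 < ?h")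
proof -
  interpret N: prob_space "P \<theta> \<gamma>" using assms(1,2) by (rule prob)
  obtain \<epsilon> where \<epsilon>: "\<epsilon> > 0" "\<And>t. \<bar>t\<bar> < \<epsilon> \<Longrightarrow> \<theta> + t *\<^sub>R v \<in> \<Theta>"
    using segment_in_Theta[OF assms(1)] by blast
  define u where "u t = \<psi> (\<theta> + t *\<^sub>R v) \<gamma> - \<psi> \<theta> \<gamma>" for t
  define u' where "u' t = (\<Sum>j\<in>UNIV. v $ j * dpsi j (\<theta> + t *\<^sub>R v, \<gamma>))" for t
  have u: "(u has_real_derivative u' t) (at t)" if "\<bar>t\<bar> < \<epsilon>" for t
    using psi_along_line[OF \<epsilon>(2)[OF that] assms(2)]
    unfolding u_def u'_def by (auto intro!: derivative_eq_intros)
  have u': "(u' has_real_derivative ?h) (at 0)"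
    unfolding u'_def using dpsi_along_line[OF assms(1,2)]
    by (auto intro!: derivative_eq_intros simp: mult.commute)
  \<comment> \<open>The mean of the statistic, by \<open>expectation_stat\<close>.\<close>
  define m where "m = u' 0"
  \<comment> \<open>Centring at the mean makes \<open>E Y\<^sup>2\<close> the variance and leaves the second derivative at \<open>0\<close> unchanged.\<close>
  define Y where "Y x = stat v x - m" for x
  have e: "exp (t * Y x) = exp (t * stat v x) * exp (- (t * m))" for t x
    by (simp add: Y_def algebra_simps flip: exp_add)
  have mgf: "integrable (P \<theta> \<gamma>) (\<lambda>x. exp (t * Y x))"
    "N.expectation (\<lambda>x. exp (t * Y x)) = exp (u t - t * m)" if "\<bar>t\<bar> < \<epsilon>" for t
  proof -
    have raw: "integrable (P \<theta> \<gamma>) (\<lambda>x. exp (t * stat v x))"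
      "N.expectation (\<lambda>x. exp (t * stat v x)) = exp (u t)"
      using exp_moment[OF assms(1) \<epsilon>(2)[OF that] assms(2)] by (simp_all add: stat_scaleR u_def)
    show "integrable (P \<theta> \<gamma>) (\<lambda>x. exp (t * Y x))"
      unfolding e using raw(1) by simp
    show "N.expectation (\<lambda>x. exp (t * Y x)) = exp (u t - t * m)"
      unfolding e using raw(2) by (simp add: exp_diff exp_minus divide_inverse)
  qed
  have Y_meas: "Y \<in> borel_measurable (P \<theta> \<gamma>)" unfolding Y_def by measurable
  have K: "((\<lambda>t. exp (u t - t * m)) has_real_derivative exp (u t - t * m) * (u' t - m)) (at t)"
    if "\<bar>t\<bar> < \<epsilon>" for t
    using u[OF that] by (auto intro!: derivative_eq_intros)
  have "u 0 = 0" by (simp add: u_def)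
  have "((\<lambda>t. exp (u t - t * m) * (u' t - m)) has_real_derivative ?h) (at 0)"
    using DERIV_mult[OF K[of 0] DERIV_diff[OF u' DERIV_const[of m]]] \<epsilon>(1) \<open>u 0 = 0\<close>
    by (simp add: m_def)
  note second = N.second_moment_le_mgf_second_derivative[OF Y_meas \<epsilon>(1) mgf K this]
  have "N.expectation (\<lambda>x. (Y x)\<^sup>2) \<noteq> 0"
  proof
    assume "N.expectation (\<lambda>x. (Y x)\<^sup>2) = 0"
    then have ae: "AE x in P \<theta> \<gamma>. stat v x = m"
      using integral_nonneg_eq_0_iff_AE[OF second(1)] by (simp add: Y_def)
    \<comment> \<open>The direction is scaled so that the second parameter lies in \<open>\<Theta>\<close>.\<close>
    define s where "s = \<epsilon> / 2"
    have s: "s > 0" "\<bar>s\<bar> < \<epsilon>" using \<epsilon>(1) by (auto simp: s_def)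
    have "AE x in P \<theta> \<gamma>. stat ((\<theta> + s *\<^sub>R v) - \<theta>) x = s * m"
      using ae by (auto simp: stat_scaleR)
    then have "\<theta> = \<theta> + s *\<^sub>R v"
      using assms(1,2) \<epsilon>(2)[OF s(2)] by (intro eq_if_stat_AE_const)
    then show False using s(1) assms(3) by simp
  qed
  moreover have "0 \<le> N.expectation (\<lambda>x. (Y x)\<^sup>2)" by simp
  ultimately show ?thesis using second(2) by linarith
qed

lemma g_theta_positive_definite:
  assumes "\<theta> \<in> \<Theta>" "\<gamma> \<in> I" "v \<noteq> 0"
  shows "0 < v \<bullet> (g_theta \<theta> \<gamma> *v v)"
proof -
  have "v \<bullet> (g_theta \<theta> \<gamma> *v v) = (\<Sum>i\<in>UNIV. \<Sum>j\<in>UNIV. v $ i * (v $ j * ddpsi i j (\<theta>, \<gamma>)))"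
    using assms by (simp add: inner_vec_def matrix_vector_mult_def g_theta_eq sum_distrib_left mult_ac)
  also have "\<dots> = (\<Sum>j\<in>UNIV. v $ j * (\<Sum>i\<in>UNIV. v $ i * ddpsi i j (\<theta>, \<gamma>)))"
    by (subst sum.swap) (simp add: sum_distrib_left mult_ac)
  finally show ?thesis using hessian_pos[OF assms] by simp
qed

text \<open>
  With \<open>Y\<close> the log-likelihood ratio, \<open>0 \<le> E (exp Y - 1 - Y) = - E Y\<close>, the relative entropy of the
  two members.  It takes the place of the tangent inequality for convex functions, which would ask for
  the segment from \<open>\<theta>1\<close> to \<open>\<theta>2\<close> to lie in \<open>\<Theta>\<close>.  Equality forces \<open>exp Y = 1 + Y\<close> almost surely and
  hence \<open>Y = 0\<close>.
\<close>
lemma tangent_le_psi: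
  assumes "\<theta>1 \<in> \<Theta>" "\<theta>2 \<in> \<Theta>" "\<gamma> \<in> I"
  shows "(\<theta>2 - \<theta>1) \<bullet> eta \<theta>1 \<gamma> \<le> \<psi> \<theta>2 \<gamma> - \<psi> \<theta>1 \<gamma>"
    and "(\<theta>2 - \<theta>1) \<bullet> eta \<theta>1 \<gamma> = \<psi> \<theta>2 \<gamma> - \<psi> \<theta>1 \<gamma> \<Longrightarrow> \<theta>1 = \<theta>2"
proof -
  interpret N: prob_space "P \<theta>1 \<gamma>" using assms(1,3) by (rule prob)
  define c where "c = \<psi> \<theta>2 \<gamma> - \<psi> \<theta>1 \<gamma>"
  define Y where "Y x = stat (\<theta>2 - \<theta>1) x - c" for x
  have e: "exp (Y x) = exp (stat (\<theta>2 - \<theta>1) x) * exp (- c)" for x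
    by (simp add: Y_def flip: exp_add)
  have eY: "integrable (P \<theta>1 \<gamma>) (\<lambda>x. exp (Y x))" "N.expectation (\<lambda>x. exp (Y x)) = 1"
    using exp_moment[OF assms] unfolding e by (simp_all only: c_def integrable_mult_left integral_mult_left_zero)
      (simp flip: exp_add)
  have Y: "integrable (P \<theta>1 \<gamma>) Y" "N.expectation Y = (\<theta>2 - \<theta>1) \<bullet> eta \<theta>1 \<gamma> - c"
    using expectation_stat[OF assms(1,3), of "\<theta>2 - \<theta>1"] N.prob_space
    unfolding Y_def[abs_def] by simp_all
  have int: "integrable (P \<theta>1 \<gamma>) (\<lambda>x. exp (Y x) - 1 - Y x)" using eY Y by simp
  have nonneg: "0 \<le> exp (Y x) - 1 - Y x" for x
    using exp_ge_add_one_self[of "Y x"] by linarith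
  have ex: "N.expectation (\<lambda>x. exp (Y x) - 1 - Y x) = c - (\<theta>2 - \<theta>1) \<bullet> eta \<theta>1 \<gamma>"
    using eY Y N.prob_space by simp
  show "(\<theta>2 - \<theta>1) \<bullet> eta \<theta>1 \<gamma> \<le> \<psi> \<theta>2 \<gamma> - \<psi> \<theta>1 \<gamma>"
    using ex Bochner_Integration.integral_nonneg[of "P \<theta>1 \<gamma>" "\<lambda>x. exp (Y x) - 1 - Y x"] nonneg
    by (simp add: c_def)
  assume "(\<theta>2 - \<theta>1) \<bullet> eta \<theta>1 \<gamma> = \<psi> \<theta>2 \<gamma> - \<psi> \<theta>1 \<gamma>"
  then have "AE x in P \<theta>1 \<gamma>. exp (Y x) - 1 - Y x = 0"
    using ex nonneg by (subst integral_nonneg_eq_0_iff_AE[OF int, symmetric]) (auto simp: c_def)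
  then have "AE x in P \<theta>1 \<gamma>. stat (\<theta>2 - \<theta>1) x = c"
  proof eventually_elim
    case (elim x)
    then have "exp (Y x) = 1" by (intro ln_eq_minus_one) auto
    then show ?case by (simp add: Y_def)
  qed
  then show "\<theta>1 = \<theta>2" by (rule eq_if_stat_AE_const[OF assms])
qed

text \<open>
  If the two gradients agree, the tangent inequalities at \<open>\<theta>1\<close> and at \<open>\<theta>2\<close> are opposite to
  each other, so both are equalities.
\<close>
lemma eta_inj:
  assumes "\<theta>1 \<in> \<Theta>" "\<theta>2 \<in> \<Theta>" "\<gamma> \<in> I" "eta \<theta>1 \<gamma> = eta \<theta>2 \<gamma>"
  shows "\<theta>1 = \<theta>2"
proof (rule tangent_le_psi(2)[OF assms(1-3)])
  have "(\<theta>1 - \<theta>2) \<bullet> eta \<theta>1 \<gamma> \<le> \<psi> \<theta>1 \<gamma> - \<psi> \<theta>2 \<gamma>"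
    using tangent_le_psi(1)[OF assms(2,1,3)] assms(4) by simp
  then show "(\<theta>2 - \<theta>1) \<bullet> eta \<theta>1 \<gamma> = \<psi> \<theta>2 \<gamma> - \<psi> \<theta>1 \<gamma>"
    using tangent_le_psi(1)[OF assms(1-3)] by (simp add: inner_diff_left)
qed

section \<open>Monotonicity in the truncation parameter\<close>

lemma exp_psi_eq_integral:
  assumes "\<theta> \<in> \<Theta>" "\<gamma> \<in> I"
  shows "integrable lborel (\<lambda>x. q x \<theta> * indicator (support \<gamma>) x)"
    and "(\<integral>x. q x \<theta> * indicator (support \<gamma>) x \<partial>lborel) = exp (\<psi> \<theta> \<gamma>)"
proof -
  interpret N: prob_space "P \<theta> \<gamma>" using assms by (rule prob)
  have "(\<integral>\<^sup>+x. ennreal (p x \<theta> \<gamma>) \<partial>lborel) = emeasure (P \<theta> \<gamma>) UNIV"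
    using assms(2) by (simp add: P_def emeasure_density)
  then have "(\<integral>\<^sup>+x. ennreal (p x \<theta> \<gamma>) \<partial>lborel) = ennreal 1"
    using N.emeasure_space_1 by simp
  then have *: "integrable lborel (\<lambda>x. p x \<theta> \<gamma>)" "(\<integral>x. p x \<theta> \<gamma> \<partial>lborel) = 1"
    using nn_integral_eq_integrable[of "\<lambda>x. p x \<theta> \<gamma>" lborel 1] assms(2) p_nonneg by auto
  have e: "q x \<theta> * indicator (support \<gamma>) x = exp (\<psi> \<theta> \<gamma>) * p x \<theta> \<gamma>" for x
    by (simp add: p_eq exp_minus)
  show "integrable lborel (\<lambda>x. q x \<theta> * indicator (support \<gamma>) x)"
    "(\<integral>x. q x \<theta> * indicator (support \<gamma>) x \<partial>lborel) = exp (\<psi> \<theta> \<gamma>)"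
    unfolding e using * by simp_all
qed

lemma psi_has_gamma_derivative:
  assumes "\<theta> \<in> \<Theta>" "\<gamma> \<in> I"
  shows "(\<psi> \<theta> has_real_derivative frechet_derivative psi_pair (at (\<theta>, \<gamma>)) (0, 1)) (at \<gamma>)"
proof -
  have "(psi_pair has_derivative frechet_derivative psi_pair (at (\<theta>, \<gamma>))) (at ((\<theta>, 0) + \<gamma> *\<^sub>R (0, 1)))"
    using psi_derivative[of "(\<theta>, \<gamma>)"] assms by simp
  from has_real_derivative_along_line[OF this] show ?thesis
    by (simp add: psi_pair_def)
qed

text \<open>
  By \<open>exp_psi_eq_integral\<close>, \<open>exp (\<psi> \<theta> \<cdot>)\<close> loses at least \<open>c (s - \<gamma>)\<close> between
  \<open>\<gamma>\<close> and \<open>s\<close>, where \<open>c > 0\<close> is the minimum of \<open>q\<close> on a compact interval to the right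
  of \<open>\<gamma>\<close>.
\<close>
lemma deriv_psi_gamma_neg:
  assumes "\<theta> \<in> \<Theta>" "\<gamma> \<in> I"
  shows "deriv (\<psi> \<theta>) \<gamma> < 0"
proof -
  obtain b where b: "b \<in> I" "\<gamma> < b" using assms(2) by (rule exists_greater_in_I)
  have "support \<gamma> \<subseteq> I" using assms(2) by (rule support_subset_I)
  have "ereal b < I2" using b(1) by (simp add: I_def einterval_def)
  then have "ereal x < I2" if "x \<le> b" for x
    using that le_less_trans[of "ereal x" "ereal b" I2] by simp
  then have sub: "{\<gamma>..b} \<subseteq> support \<gamma>" by (auto simp: support_def)
  then have subI: "{\<gamma>..b} \<subseteq> I" using \<open>support \<gamma> \<subseteq> I\<close> by blast
  obtain x0 where x0: "\<And>y. y \<in> {\<gamma>..b} \<Longrightarrow> q x0 \<theta> \<le> q y \<theta>"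
    using continuous_attains_inf[of "{\<gamma>..b}" "\<lambda>x. q x \<theta>"] continuous_on_subset[OF continuous_on_q subI] b(2)
    by fastforce
  define c where "c = q x0 \<theta>"
  have "c > 0" by (simp add: c_def q_def)
  have decr: "exp (\<psi> \<theta> s) + c * (s - \<gamma>) \<le> exp (\<psi> \<theta> \<gamma>)" if s: "\<gamma> < s" "s \<le> b" for s
  proof -
    have "s \<in> I" using s subI by auto
    have "q x \<theta> * indicator (support s) x + c * indicator {\<gamma>..<s} x \<le> q x \<theta> * indicator (support \<gamma>) x" for x
    proof -
      have "c \<le> q x \<theta>" "x \<in> support \<gamma>" "x \<notin> support s" if "x \<in> {\<gamma>..<s}"
        using that s x0[of x] subsetD[OF sub, of x] by (auto simp: c_def support_def)
      moreover have "x \<in> support \<gamma>" if "x \<in> support s" using that s by (auto simp: support_def)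
      moreover have "0 \<le> q x \<theta>" by (simp add: q_def)
      ultimately show ?thesis by (auto simp: indicator_def)
    qed
    moreover have ind: "integrable lborel (\<lambda>x. c * indicator {\<gamma>..<s} x :: real)"
      using s(1) by (intro integrable_mult_right integrable_real_indicator) auto
    moreover note exp_psi_eq_integral(1)[OF assms] exp_psi_eq_integral(1)[OF assms(1) \<open>s \<in> I\<close>]
    ultimately have "(\<integral>x. q x \<theta> * indicator (support s) x + c * indicator {\<gamma>..<s} x \<partial>lborel)
        \<le> (\<integral>x. q x \<theta> * indicator (support \<gamma>) x \<partial>lborel)"
      by (intro integral_mono Bochner_Integration.integrable_add)
    also have "\<dots> = exp (\<psi> \<theta> \<gamma>)" by (rule exp_psi_eq_integral(2)[OF assms])
    finally show ?thesis
      using exp_psi_eq_integral[OF assms(1) \<open>s \<in> I\<close>] ind s(1) by simp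
  qed
  define D where "D = deriv (\<psi> \<theta>) \<gamma>"
  have D: "(\<psi> \<theta> has_real_derivative D) (at \<gamma>)"
    using psi_has_gamma_derivative[OF assms] DERIV_imp_deriv unfolding D_def by metis
  have f: "((\<lambda>s. exp (\<psi> \<theta> s) + c * (s - \<gamma>)) has_real_derivative exp (\<psi> \<theta> \<gamma>) * D + c) (at \<gamma>)"
    using D by (auto intro!: derivative_eq_intros)
  have "exp (\<psi> \<theta> \<gamma>) * D + c \<le> 0"
  proof (rule ccontr)
    assume "\<not> ?thesis"
    then obtain d where d: "d > 0"
      "\<And>h. h > 0 \<Longrightarrow> h < d \<Longrightarrow> exp (\<psi> \<theta> \<gamma>) < exp (\<psi> \<theta> (\<gamma> + h)) + c * h"
      using has_real_derivative_pos_inc_right[OF f] by auto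
    define h where "h = min d (b - \<gamma>) / 2"
    have "0 < h" "h < d" "\<gamma> + h \<le> b" using d(1) b(2) by (auto simp: h_def min_def field_simps)
    then show False using d(2)[of h] decr[of "\<gamma> + h"] by simp
  qed
  then have "exp (\<psi> \<theta> \<gamma>) * D < 0" using \<open>c > 0\<close> by linarith
  then show ?thesis by (simp add: D_def mult_less_0_iff)
qed

section \<open>Mixed coordinates\<close>

definition mixed_coords :: "(real ^ 'd) \<times> real \<Rightarrow> (real ^ 'd) \<times> real" where
  "mixed_coords z = (eta (fst z) (snd z), snd z)"

text \<open>
  Totalized in the same way as \<open>at_eta\<close>, which is therefore composition with this map.
\<close>
definition mixed_inv :: "(real ^ 'd) \<times> real \<Rightarrow> (real ^ 'd) \<times> real" where
  "mixed_inv w = ((THE \<theta>. \<theta> \<in> \<Theta> \<and> eta \<theta> (snd w) = fst w), snd w)"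

lemma at_eta_eq: "at_eta f \<eta> \<gamma> = (\<lambda>z. f (fst z) (snd z)) (mixed_inv (\<eta>, \<gamma>))"
  by (simp add: at_eta_def mixed_inv_def)

lemma mixed_inv_mixed_coords:
  assumes "z \<in> \<Theta> \<times> I"
  shows "mixed_inv (mixed_coords z) = z"
proof -
  have "(THE \<theta>. \<theta> \<in> \<Theta> \<and> eta \<theta> (snd z) = eta (fst z) (snd z)) = fst z"
    using assms eta_inj by (intro the_equality) auto
  then show ?thesis by (simp add: mixed_inv_def mixed_coords_def prod_eq_iff)
qed

lemma mixed_coords_derivative:
  assumes "z \<in> \<Theta> \<times> I"
  shows "(mixed_coords has_derivative (\<lambda>h. (\<chi> j. frechet_derivative (dpsi j) (at z) h, snd h))) (at z)"
proof -
  have "((\<lambda>z. (\<chi> j. dpsi j z, snd z)) has_derivative (\<lambda>h. (\<chi> j. frechet_derivative (dpsi j) (at z) h, snd h))) (at z)"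
    using dpsi_derivative[OF assms]
    by (intro has_derivative_Pair has_derivative_vec_lambda has_derivative_snd has_derivative_ident)
  then show ?thesis
    by (rule has_derivative_transform_within_open[OF _ open_parameters assms])
      (auto simp: mixed_coords_def eta_eq)
qed

text \<open>
  A vector in the kernel has the form \<open>(v, 0)\<close> with \<open>v\<close> in the kernel of the Hessian in
  \<open>\<theta>\<close>.
\<close>
lemma mixed_coords_derivative_inj:
  assumes "z \<in> \<Theta> \<times> I"
  shows "inj (\<lambda>h. (\<chi> j. frechet_derivative (dpsi j) (at z) h, snd h))" (is "inj ?D")
proof -
  have "linear ?D"
    using mixed_coords_derivative[OF assms] by (rule has_derivative_linear)
  moreover have "h = 0" if "?D h = 0" for h
  proof -
    have h: "frechet_derivative (dpsi j) (at z) h = 0" "snd h = 0" for j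
      using that by (auto simp: prod_eq_iff vec_eq_iff)
    obtain v where v: "h = (v, 0)" using h(2) by (metis prod.collapse)
    have "(\<Sum>i\<in>UNIV. v $ i * ddpsi i j z) = 0" for j
      using linear_on_first_component[OF has_derivative_linear[OF dpsi_derivative[OF assms, of j]], of v] h(1)
      by (simp add: v ddpsi_def)
    then have "v = 0"
      using hessian_pos[of "fst z" "snd z" v] assms by (cases "v = 0") auto
    then show "h = 0" by (simp add: v zero_prod_def)
  qed
  ultimately show ?thesis by (simp add: linear_injective_0)
qed

lemma mixed_inv_differentiable:
  assumes "z \<in> \<Theta> \<times> I"
  shows "mixed_inv differentiable (at (mixed_coords z))"
proof -
  let ?D = "\<lambda>h. (\<chi> j. frechet_derivative (dpsi j) (at z) h, snd h)"
  obtain g where g: "\<And>x. ?D (g x) = x"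
    using linear_injective_isomorphism[OF has_derivative_linear[OF mixed_coords_derivative[OF assms]]
        mixed_coords_derivative_inj[OF assms]] by blast
  have cont: "continuous_on (\<Theta> \<times> I) mixed_coords"
    using mixed_coords_derivative
    by (intro continuous_at_imp_continuous_on ballI has_derivative_continuous)
  have comp: "?D \<circ> g = id" using g by (auto simp: fun_eq_iff)
  have "(mixed_inv has_derivative g) (at (mixed_coords z))"
    by (rule has_derivative_inverse_strong[OF open_parameters assms cont mixed_inv_mixed_coords
          mixed_coords_derivative[OF assms] comp])
  then show ?thesis by (auto simp: differentiable_def)
qed

lemma det_g_theta_pos: "\<theta> \<in> \<Theta> \<Longrightarrow> \<gamma> \<in> I \<Longrightarrow> 0 < det (g_theta \<theta> \<gamma>)"
  by (intro det_pos_if_positive_definite g_theta_positive_definite)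

lemma g_gamma_pos: "\<theta> \<in> \<Theta> \<Longrightarrow> \<gamma> \<in> I \<Longrightarrow> 0 < g_gamma \<theta> \<gamma>"
  using deriv_psi_gamma_neg by (force simp: g_gamma_def)

lemma V_pos: "\<theta> \<in> \<Theta> \<Longrightarrow> \<gamma> \<in> I \<Longrightarrow> 0 < V \<rho> \<tau> \<theta> \<gamma>"
  using det_g_theta_pos g_gamma_pos by (simp add: V_def less_le)

text \<open>
  The Leibniz formula exhibits the determinant as a polynomial in the smooth entries of the Hessian; the
  real powers are differentiable because their bases are positive.
\<close>
lemma V_differentiable:
  assumes "z \<in> \<Theta> \<times> I"
  shows "(\<lambda>z. V \<rho> \<tau> (fst z) (snd z)) differentiable (at z)"
proof -
  have "(\<lambda>z. \<Sum>\<sigma>\<in>{\<sigma>. \<sigma> permutes UNIV}. of_int (sign \<sigma>) * (\<Prod>i\<in>UNIV. ddpsi i (\<sigma> i) z)) differentiable (at z)"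
  proof -
    have "ddpsi i j differentiable (at z)" for i j
      using smooth_on_has_derivative[OF smooth_on_frechet_derivative[OF smooth_dpsi] assms]
      unfolding ddpsi_def[abs_def] differentiable_def by blast
    then show ?thesis
      by (intro differentiable_sum ballI differentiable_mult differentiable_prod) (auto simp: finite_permutations)
  qed
  then have det: "(\<lambda>z. det (g_theta (fst z) (snd z))) differentiable (at z)"
    by (rule differentiable_transform_on_open[OF _ open_parameters assms])
      (auto simp: det_def g_theta_eq)
  have "(\<lambda>z. (frechet_derivative psi_pair (at z) (0, 1))\<^sup>2) differentiable (at z)"
    using smooth_on_has_derivative[OF smooth_on_frechet_derivative[OF smooth_psi] assms]
    by (intro differentiable_power) (auto simp: differentiable_def)
  then have gg: "(\<lambda>z. g_gamma (fst z) (snd z)) differentiable (at z)"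
    by (rule differentiable_transform_on_open[OF _ open_parameters assms])
      (auto simp: g_gamma_def DERIV_imp_deriv[OF psi_has_gamma_derivative])
  have powr: "(\<lambda>z. f z powr a) differentiable (at z)" if "f differentiable (at z)" "0 < f z"
    for f :: "(real ^ 'd) \<times> real \<Rightarrow> real" and a
    using that has_derivative_powr[OF _ has_derivative_const, of f _ z UNIV a] unfolding differentiable_def by auto
  show ?thesis
    unfolding V_def using det gg det_g_theta_pos g_gamma_pos assms
    by (intro differentiable_mult powr) auto
qed

lemma I'_E:
  assumes "\<gamma> \<in> I' \<eta>0"
  obtains z where "z \<in> \<Theta> \<times> I" "mixed_coords z = (\<eta>0, \<gamma>)" "mixed_inv (\<eta>0, \<gamma>) = z"
proof -
  obtain \<theta> where \<theta>: "\<theta> \<in> \<Theta>" "\<gamma> \<in> I" "eta \<theta> \<gamma> = \<eta>0"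
    using assms by (auto simp: I'_def H_def)
  have "mixed_coords (\<theta>, \<gamma>) = (\<eta>0, \<gamma>)" by (simp add: mixed_coords_def \<theta>)
  with \<theta>(1,2) show ?thesis
    using that[of "(\<theta>, \<gamma>)"] mixed_inv_mixed_coords[of "(\<theta>, \<gamma>)"] by simp
qed

lemma at_eta_V_pos: "\<gamma> \<in> I' \<eta>0 \<Longrightarrow> 0 < at_eta (V \<rho> \<tau>) \<eta>0 \<gamma>"
  using V_pos by (elim I'_E) (auto simp: at_eta_eq)

lemma at_eta_V_differentiable:
  assumes "\<gamma> \<in> I' \<eta>0"
  shows "at_eta (V \<rho> \<tau>) \<eta>0 differentiable (at \<gamma>)"
proof -
  obtain z where z: "z \<in> \<Theta> \<times> I" "mixed_coords z = (\<eta>0, \<gamma>)" "mixed_inv (\<eta>0, \<gamma>) = z"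
    using assms by (rule I'_E)
  have "((\<lambda>\<gamma>. (\<eta>0, \<gamma>)) has_derivative (\<lambda>h. (0, h))) (at \<gamma>)"
    by (rule has_derivative_Pair[OF has_derivative_const has_derivative_ident])
  then have "(\<lambda>\<gamma>. (\<eta>0, \<gamma>)) differentiable (at \<gamma>)" by (rule differentiableI)
  moreover have "mixed_inv differentiable (at (\<eta>0, \<gamma>))"
    using mixed_inv_differentiable[OF z(1)] z(2) by simp
  ultimately have "(mixed_inv \<circ> (\<lambda>\<gamma>. (\<eta>0, \<gamma>))) differentiable (at \<gamma>)"
    by (rule differentiable_chain_at)
  then have "((\<lambda>z. V \<rho> \<tau> (fst z) (snd z)) \<circ> (mixed_inv \<circ> (\<lambda>\<gamma>. (\<eta>0, \<gamma>)))) differentiable (at \<gamma>)"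
    by (rule differentiable_chain_at) (use V_differentiable[OF z(1)] z(3) in simp)
  then show ?thesis by (simp add: o_def at_eta_eq[abs_def])
qed

section \<open>Matching priors\<close>

text \<open>
  Both matching conditions have this shape and differ in the exponents \<open>\<rho>\<close> and \<open>\<tau>\<close> only.
\<close>
lemma at_eta_V_prior:
  "(\<forall>\<gamma>\<in>I' \<eta>0. at_eta (V \<rho> \<tau>) \<eta>0 \<gamma> > 0) \<and> at_eta (V \<rho> \<tau>) \<eta>0 differentiable_on I' \<eta>0 \<and>
   (\<forall>\<gamma>\<in>I' \<eta>0. ((\<lambda>\<gamma>'. ln (at_eta (V \<rho> \<tau>) \<eta>0 \<gamma>') - ln (at_eta (V \<rho> \<tau>) \<eta>0 \<gamma>'))
      has_real_derivative 0) (at \<gamma> within I' \<eta>0))"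
  using at_eta_V_pos at_eta_V_differentiable
  by (simp add: differentiable_at_imp_differentiable_on)

lemma prob_matching_prior_V: "prob_matching_prior \<eta>0 (at_eta (V (1/2) 0) \<eta>0)"
  unfolding prob_matching_prior_def by (rule at_eta_V_prior)

lemma moment_matching_prior_V: "moment_matching_prior \<eta>0 (at_eta (V 0 (1/2)) \<eta>0)"
  unfolding moment_matching_prior_def by (rule at_eta_V_prior)

lemma at_eta_V_prob_matching:
  "\<gamma> \<in> I' \<eta>0 \<Longrightarrow>
   at_eta (V (1/2) 0) \<eta>0 \<gamma> = at_eta (\<lambda>\<theta> \<gamma>. det (g_theta \<theta> \<gamma>)) \<eta>0 \<gamma> * sqrt (at_eta g_gamma \<eta>0 \<gamma>)"
  using det_g_theta_pos g_gamma_pos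
  by (elim I'_E) (auto simp: at_eta_eq V_def powr_half_sqrt less_imp_le)

lemma at_eta_V_moment_matching:
  "\<gamma> \<in> I' \<eta>0 \<Longrightarrow>
   at_eta (V 0 (1/2)) \<eta>0 \<gamma> = sqrt (at_eta (\<lambda>\<theta> \<gamma>. det (g_theta \<theta> \<gamma>)) \<eta>0 \<gamma>) * at_eta g_gamma \<eta>0 \<gamma>"
  using det_g_theta_pos g_gamma_pos
  by (elim I'_E) (auto simp: at_eta_eq V_def powr_half_sqrt less_imp_le)

end

text \<open>
  The logarithm of the quotient has derivative \<open>0\<close> within \<open>C\<close>, and a connected set of reals is
  convex.
\<close>
lemma proportional_on_if_log_derivatives_eq:
  fixes f g h :: "real \<Rightarrow> real"
  assumes "\<And>x. x \<in> J \<Longrightarrow> 0 < f x" "\<And>x. x \<in> J \<Longrightarrow> 0 < g x"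
    and "\<And>x. x \<in> J \<Longrightarrow> ((\<lambda>x. ln (f x) - ln (h x)) has_real_derivative 0) (at x within J)"
    and "\<And>x. x \<in> J \<Longrightarrow> ((\<lambda>x. ln (g x) - ln (h x)) has_real_derivative 0) (at x within J)"
    and "C \<subseteq> J" "connected C"
  shows "proportional_on C f g"
proof -
  have "((\<lambda>x. ln (f x) - ln (g x)) has_real_derivative 0) (at x within C)" if "x \<in> C" for x
  proof -
    have "x \<in> J" using that assms(5) by blast
    from DERIV_diff[OF assms(3,4)[OF this]]
    show ?thesis using assms(5) by (auto intro: has_field_derivative_subset)
  qed
  then have "((\<lambda>x. ln (f x) - ln (g x)) has_derivative (\<lambda>h. 0)) (at x within C)" if "x \<in> C" for x
    using that by (simp add: has_field_derivative_def lambda_zero)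
  moreover have "convex C" using assms(6) by (simp add: is_interval_connected_1 flip: is_interval_convex_1)
  ultimately have "\<exists>c. \<forall>x\<in>C. ln (f x) - ln (g x) = c"
    by (intro has_derivative_zero_constant)
  then obtain c where c: "\<And>x. x \<in> C \<Longrightarrow> ln (f x) = c + ln (g x)" by (auto simp: algebra_simps)
  have "f x = exp c * g x" if "x \<in> C" for x
  proof -
    have "0 < f x" "0 < g x" using that assms(1,2,5) by auto
    then show ?thesis using c[OF that] by (metis exp_add exp_ln)
  qed
  then show ?thesis unfolding proportional_on_def using exp_gt_zero by blast
qed

lemma proportional_on_refl: "proportional_on S f f"
  unfolding proportional_on_def by (rule exI[of _ 1]) simp

theorem theorem4:
  fixes \<Theta> :: "(real ^ 'd::finite) set"
    and I1 I2 :: ereal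
    and F :: "'d \<Rightarrow> real \<Rightarrow> real"
    and M :: "real \<Rightarrow> real"
    and \<psi> :: "real ^ 'd \<Rightarrow> real \<Rightarrow> real"
    and \<eta>0 :: "real ^ 'd"
  assumes "oTEF \<Theta> I1 I2 F M \<psi>"
    and "\<eta>0 \<in> oTEF_data.H' \<Theta> I1 I2 \<psi>"
  shows
    "let J = oTEF_data.I' \<Theta> I1 I2 \<psi> \<eta>0;
         PM = oTEF_data.prob_matching_prior \<Theta> I1 I2 F M \<psi> \<eta>0;
         MM = oTEF_data.moment_matching_prior \<Theta> I1 I2 F M \<psi> \<eta>0;
         V_PM = oTEF_data.at_eta \<Theta> \<psi> (oTEF_data.V I2 F M \<psi> (1/2) 0) \<eta>0;
         V_MM = oTEF_data.at_eta \<Theta> \<psi> (oTEF_data.V I2 F M \<psi> 0 (1/2)) \<eta>0;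
         det_g = oTEF_data.at_eta \<Theta> \<psi> (\<lambda>\<theta> \<gamma>. det (oTEF_data.g_theta I2 F M \<psi> \<theta> \<gamma>)) \<eta>0;
         g_gamma = oTEF_data.at_eta \<Theta> \<psi> (oTEF_data.g_gamma \<psi>) \<eta>0
     in (\<exists>\<pi>. PM \<pi> \<and> proportional_on J \<pi> V_PM) \<and>
        (\<exists>\<pi>. MM \<pi> \<and> proportional_on J \<pi> V_MM) \<and>
        (\<forall>C. C \<subseteq> J \<and> connected C \<longrightarrow>
           (\<forall>\<pi>1 \<pi>2. PM \<pi>1 \<and> PM \<pi>2 \<longrightarrow> proportional_on C \<pi>1 \<pi>2) \<and>
           (\<forall>\<pi>1 \<pi>2. MM \<pi>1 \<and> MM \<pi>2 \<longrightarrow> proportional_on C \<pi>1 \<pi>2) \<and>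
           (\<forall>\<pi>. PM \<pi> \<longrightarrow> proportional_on C \<pi> V_PM) \<and>
           (\<forall>\<pi>. MM \<pi> \<longrightarrow> proportional_on C \<pi> V_MM)) \<and>
        (\<forall>\<gamma>\<in>J. V_PM \<gamma> = det_g \<gamma> * sqrt (g_gamma \<gamma>)) \<and>
        (\<forall>\<gamma>\<in>J. V_MM \<gamma> = sqrt (det_g \<gamma>) * g_gamma \<gamma>)"
proof -
  interpret oTEF \<Theta> I1 I2 F M \<psi> by (rule assms(1))
  have PM: "proportional_on C \<pi>1 \<pi>2"
    if "C \<subseteq> I' \<eta>0" "connected C" "prob_matching_prior \<eta>0 \<pi>1" "prob_matching_prior \<eta>0 \<pi>2" for C \<pi>1 \<pi>2
    using that unfolding prob_matching_prior_def
    by (intro proportional_on_if_log_derivatives_eq[of "I' \<eta>0" \<pi>1 \<pi>2 "at_eta (V (1/2) 0) \<eta>0"]) blast+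
  have MM: "proportional_on C \<pi>1 \<pi>2"
    if "C \<subseteq> I' \<eta>0" "connected C" "moment_matching_prior \<eta>0 \<pi>1" "moment_matching_prior \<eta>0 \<pi>2" for C \<pi>1 \<pi>2
    using that unfolding moment_matching_prior_def
    by (intro proportional_on_if_log_derivatives_eq[of "I' \<eta>0" \<pi>1 \<pi>2 "at_eta (V 0 (1/2)) \<eta>0"]) blast+
  show ?thesis
    unfolding Let_def
  proof (intro conjI allI impI ballI)
    show "\<exists>\<pi>. prob_matching_prior \<eta>0 \<pi> \<and> proportional_on (I' \<eta>0) \<pi> (at_eta (V (1/2) 0) \<eta>0)"
      using prob_matching_prior_V proportional_on_refl by (intro exI conjI)
    show "\<exists>\<pi>. moment_matching_prior \<eta>0 \<pi> \<and> proportional_on (I' \<eta>0) \<pi> (at_eta (V 0 (1/2)) \<eta>0)"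
      using moment_matching_prior_V proportional_on_refl by (intro exI conjI)
  qed (use PM MM prob_matching_prior_V moment_matching_prior_V at_eta_V_prob_matching at_eta_V_moment_matching in \<open>simp_all\<close>)
qed

end
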